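(* Let $M$ be a dualizable object in a closed symmetric monoidal category $(\mathscr{C},\otimes,I)$, let $Q,P$ be objects of $\mathscr{C}$, and let $f:[M,Q]\to[M,P]$ be a map. Put $M^*:=[M,I]$ and let $\tilde f:Q\otimes M^*\to M^*\otimes P$ be the unique map such that $$\big(Q\otimes M^*\xrightarrow{\tilde f}M^*\otimes P\xrightarrow{s}P\otimes M^*\xrightarrow{\mu}[M,P]\big)=\big(Q\otimes M^*\xrightarrow{\mu}[M,Q]\xrightarrow{f}[M,P]\big),$$ where $s$ is the symmetry isomorphism and $\mu$ the canonical isomorphisms. Then $$\mathrm{cotr}(f)=\mathrm{tr}(\tilde f)$$ as maps $Q\to P$.
   Context: Unit and associativity isomorphisms are suppressed. $[Y,-]$ denotes the right adjoint of $-\otimes Y$, with counit $\mathrm{ev}:[Y,Z]\otimes Y\to Z$; for a map $h$, $h_*$ and $h^*$ denote the maps induced on internal homs in the target and source variable. $t:[X\otimes Y,Z]\to[X,[Y,Z]]$ is the tensor-hom isomorphism. $s$ denotes the symmetry isomorphisms. An object $M$ is dualizable if there are an object $M^*$ (a dual) and maps $\eta:I\to M\otimes M^*$, $\varepsilon:M^*\otimes M\to I$ with $(1_M\otimes\varepsilon)(\eta\otimes 1_M)=1_M$ and $(\varepsilon\otimes1_{M^*})(1_{M^*}\otimes\eta)=1_{M^*}$. If $M$ is dualizable then $[M,I]$ is a dual of $M$, with evaluation $\mathrm{ev}:[M,I]\otimes M\to I$. $\mu:X\otimes[Y,Z]\to[Y,X\otimes Z]$ is the transpose of $1\otimes\mathrm{ev}:X\otimes[Y,Z]\otimes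 Y\to X\otimes Z$; it is an isomorphism if $X$ or $Y$ is dualizable. In particular $\mu:X\otimes[M,I]\to[M,X\otimes I]\cong[M,X]$ is an isomorphism for $M$ dualizable. Cotrace: for a dual pair $(M,M^* )$, the cotrace of $f:[M,Q]\to[M,P]$ is the composite $$Q\cong[I,Q]\xrightarrow{\varepsilon^*}[M^*\otimes M,Q]\xrightarrow{t}[M^*,[M,Q]]\xrightarrow{f_*}[M^*,[M,P]]\xrightarrow{t^{-1}}[M^*\otimes M,P]\xrightarrow{s^*}[M\otimes M^*,P]\xrightarrow{\eta^*}[I,P]\cong P.$$ Trace: for a dualizable object $N$ with dual $N^*$, coevaluation $\eta'$ and evaluation $\varepsilon'$, the (twisted) trace of $g:Q\otimes N\to N\otimes P$ is $$Q\cong Q\otimes I\xrightarrow{1\otimes\eta'}Q\otimes N\otimes N^*\xrightarrow{g\otimes1}N\otimes P\otimes N^*\xrightarrow{s}N^*\otimes N\otimes P\xrightarrow{\varepsilon'\otimes1}I\otimes P\cong P.$$ Here it is applied with $N=M^*$ (which is dualizable, with dual $M^{**}=[M^*,I]$) and $g=\tilde f$. Trace and cotrace do not depend on the chosen dual pair. *)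

theory Defs
  imports Main
begin

section \<open>Categories\<close>

record ('o, 'a) category =
  Obj :: "'o set"
  Arr :: "'a set"
  Dom :: "'a \<Rightarrow> 'o"
  Cod :: "'a \<Rightarrow> 'o"
  Id :: "'o \<Rightarrow> 'a" (\<open>\<one>\<index>\<close>)
  Comp :: "'a \<Rightarrow> 'a \<Rightarrow> 'a" (infixr \<open>\<cdot>\<index>\<close> 55)

definition hom :: "('o, 'a, 'x) category_scheme \<Rightarrow> 'o \<Rightarrow> 'o \<Rightarrow> 'a set" (\<open>hom\<index>\<close>)
  where "hom\<^bsub>C\<^esub> X Y = {f \<in> Arr C. Dom C f = X \<and> Cod C f = Y}"

definition inverse_arrows :: "('o, 'a, 'x) category_scheme \<Rightarrow> 'a \<Rightarrow> 'a \<Rightarrow> bool"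
  where "inverse_arrows C f g \<longleftrightarrow>
    f \<in> Arr C \<and> g \<in> hom\<^bsub>C\<^esub> (Cod C f) (Dom C f) \<and>
    g \<cdot>\<^bsub>C\<^esub> f = \<one>\<^bsub>C\<^esub> (Dom C f) \<and> f \<cdot>\<^bsub>C\<^esub> g = \<one>\<^bsub>C\<^esub> (Cod C f)"

definition is_iso :: "('o, 'a, 'x) category_scheme \<Rightarrow> 'a \<Rightarrow> bool"
  where "is_iso C f \<longleftrightarrow> (\<exists>g. inverse_arrows C f g)"

text \<open>Unspecified unless \<open>f\<close> is an isomorphism.\<close>
definition inv_arr :: "('o, 'a, 'x) category_scheme \<Rightarrow> 'a \<Rightarrow> 'a" (\<open>inv'_arr\<index>\<close>)
  where "inv_arr\<^bsub>C\<^esub> f = (THE g. inverse_arrows C f g)"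

locale category =
  fixes C (structure)
  assumes Dom_Obj: "f \<in> Arr C \<Longrightarrow> Dom C f \<in> Obj C"
    and Cod_Obj: "f \<in> Arr C \<Longrightarrow> Cod C f \<in> Obj C"
    and Id_hom: "X \<in> Obj C \<Longrightarrow> \<one> X \<in> hom X X"
    and Comp_hom: "\<lbrakk>f \<in> hom X Y; g \<in> hom Y Z\<rbrakk> \<Longrightarrow> g \<cdot> f \<in> hom X Z"
    and Comp_Id: "f \<in> hom X Y \<Longrightarrow> f \<cdot> \<one> X = f"
    and Id_Comp: "f \<in> hom X Y \<Longrightarrow> \<one> Y \<cdot> f = f"
    and Comp_assoc:
      "\<lbrakk>f \<in> hom W X; g \<in> hom X Y; h \<in> hom Y Z\<rbrakk> \<Longrightarrow> (h \<cdot> g) \<cdot> f = h \<cdot> (g \<cdot> f)"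


section \<open>Monoidal categories\<close>

record ('o, 'a) monoidal_category = "('o, 'a) category" +
  tensor :: "'o \<Rightarrow> 'o \<Rightarrow> 'o" (infixr \<open>\<otimes>\<index>\<close> 70)
  tensor_arr :: "'a \<Rightarrow> 'a \<Rightarrow> 'a" (infixr \<open>\<otimes>\<^sub>a\<index>\<close> 70)
  unit_obj :: 'o (\<open>\<I>\<index>\<close>)
  associator :: "'o \<Rightarrow> 'o \<Rightarrow> 'o \<Rightarrow> 'a" (\<open>\<alpha>\<index>\<close>)
  lunitor :: "'o \<Rightarrow> 'a" (\<open>\<ll>\<index>\<close>)
  runitor :: "'o \<Rightarrow> 'a" (\<open>\<rr>\<index>\<close>)

locale monoidal_category = category C for C (structure) +
  assumes unit_Obj: "\<I> \<in> Obj C"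
    and tensor_Obj: "\<lbrakk>X \<in> Obj C; Y \<in> Obj C\<rbrakk> \<Longrightarrow> X \<otimes> Y \<in> Obj C"
    and tensor_hom:
      "\<lbrakk>f \<in> hom X X'; g \<in> hom Y Y'\<rbrakk> \<Longrightarrow> f \<otimes>\<^sub>a g \<in> hom (X \<otimes> Y) (X' \<otimes> Y')"
    and tensor_Id: "\<lbrakk>X \<in> Obj C; Y \<in> Obj C\<rbrakk> \<Longrightarrow> \<one> X \<otimes>\<^sub>a \<one> Y = \<one> (X \<otimes> Y)"
    and tensor_Comp:
      "\<lbrakk>f \<in> hom X X'; f' \<in> hom X' X''; g \<in> hom Y Y'; g' \<in> hom Y' Y''\<rbrakk>
        \<Longrightarrow> (f' \<cdot> f) \<otimes>\<^sub>a (g' \<cdot> g) = (f' \<otimes>\<^sub>a g') \<cdot> (f \<otimes>\<^sub>a g)"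
    and associator_hom:
      "\<lbrakk>X \<in> Obj C; Y \<in> Obj C; Z \<in> Obj C\<rbrakk>
        \<Longrightarrow> \<alpha> X Y Z \<in> hom ((X \<otimes> Y) \<otimes> Z) (X \<otimes> (Y \<otimes> Z))"
    and associator_iso:
      "\<lbrakk>X \<in> Obj C; Y \<in> Obj C; Z \<in> Obj C\<rbrakk> \<Longrightarrow> is_iso C (\<alpha> X Y Z)"
    and associator_natural:
      "\<lbrakk>f \<in> hom X X'; g \<in> hom Y Y'; h \<in> hom Z Z'\<rbrakk>
        \<Longrightarrow> \<alpha> X' Y' Z' \<cdot> ((f \<otimes>\<^sub>a g) \<otimes>\<^sub>a h) = (f \<otimes>\<^sub>a (g \<otimes>\<^sub>a h)) \<cdot> \<alpha> X Y Z"
    and lunitor_hom: "X \<in> Obj C \<Longrightarrow> \<ll> X \<in> hom (\<I> \<otimes> X) X"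
    and lunitor_iso: "X \<in> Obj C \<Longrightarrow> is_iso C (\<ll> X)"
    and lunitor_natural: "f \<in> hom X Y \<Longrightarrow> \<ll> Y \<cdot> (\<one> \<I> \<otimes>\<^sub>a f) = f \<cdot> \<ll> X"
    and runitor_hom: "X \<in> Obj C \<Longrightarrow> \<rr> X \<in> hom (X \<otimes> \<I>) X"
    and runitor_iso: "X \<in> Obj C \<Longrightarrow> is_iso C (\<rr> X)"
    and runitor_natural: "f \<in> hom X Y \<Longrightarrow> \<rr> Y \<cdot> (f \<otimes>\<^sub>a \<one> \<I>) = f \<cdot> \<rr> X"
    and pentagon:
      "\<lbrakk>W \<in> Obj C; X \<in> Obj C; Y \<in> Obj C; Z \<in> Obj C\<rbrakk>
        \<Longrightarrow> (\<one> W \<otimes>\<^sub>a \<alpha> X Y Z) \<cdot> \<alpha> W (X \<otimes> Y) Z \<cdot> (\<alpha> W X Y \<otimes>\<^sub>a \<one> Z)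
          = \<alpha> W X (Y \<otimes> Z) \<cdot> \<alpha> (W \<otimes> X) Y Z"
    and triangle:
      "\<lbrakk>X \<in> Obj C; Y \<in> Obj C\<rbrakk> \<Longrightarrow> (\<one> X \<otimes>\<^sub>a \<ll> Y) \<cdot> \<alpha> X \<I> Y = \<rr> X \<otimes>\<^sub>a \<one> Y"

record ('o, 'a) symmetric_monoidal_category = "('o, 'a) monoidal_category" +
  symmetry :: "'o \<Rightarrow> 'o \<Rightarrow> 'a" (\<open>\<s>\<index>\<close>)

locale symmetric_monoidal_category = monoidal_category C for C (structure) +
  assumes symmetry_hom:
      "\<lbrakk>X \<in> Obj C; Y \<in> Obj C\<rbrakk> \<Longrightarrow> \<s> X Y \<in> hom (X \<otimes> Y) (Y \<otimes> X)"
    and symmetry_natural: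
      "\<lbrakk>f \<in> hom X X'; g \<in> hom Y Y'\<rbrakk> \<Longrightarrow> \<s> X' Y' \<cdot> (f \<otimes>\<^sub>a g) = (g \<otimes>\<^sub>a f) \<cdot> \<s> X Y"
    and symmetry_involutive:
      "\<lbrakk>X \<in> Obj C; Y \<in> Obj C\<rbrakk> \<Longrightarrow> \<s> Y X \<cdot> \<s> X Y = \<one> (X \<otimes> Y)"
    and hexagon:
      "\<lbrakk>X \<in> Obj C; Y \<in> Obj C; Z \<in> Obj C\<rbrakk>
        \<Longrightarrow> \<alpha> Y Z X \<cdot> \<s> X (Y \<otimes> Z) \<cdot> \<alpha> X Y Z
          = (\<one> Y \<otimes>\<^sub>a \<s> X Z) \<cdot> \<alpha> Y X Z \<cdot> (\<s> X Y \<otimes>\<^sub>a \<one> Z)"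


section \<open>Closed symmetric monoidal categories\<close>

text \<open>The right adjoint of \<open>- \<otimes> Y\<close> is given by objects \<open>\<lbrakk>Y, Z\<rbrakk>\<close> and universal arrows
  \<open>ev Y Z\<close> from \<open>- \<otimes> Y\<close> to \<open>Z\<close>; its action on arrows is \<open>post\<close> below.\<close>

record ('o, 'a) closed_symmetric_monoidal_category =
    "('o, 'a) symmetric_monoidal_category" +
  ihom :: "'o \<Rightarrow> 'o \<Rightarrow> 'o" (\<open>\<lbrakk>_, _\<rbrakk>\<index>\<close>)
  eval_arr :: "'o \<Rightarrow> 'o \<Rightarrow> 'a" (\<open>ev\<index>\<close>)

locale closed_symmetric_monoidal_category = symmetric_monoidal_category C
    for C (structure) +
  assumes ihom_Obj: "\<lbrakk>Y \<in> Obj C; Z \<in> Obj C\<rbrakk> \<Longrightarrow> \<lbrakk>Y, Z\<rbrakk> \<in> Obj C"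
    and eval_hom: "\<lbrakk>Y \<in> Obj C; Z \<in> Obj C\<rbrakk> \<Longrightarrow> ev Y Z \<in> hom (\<lbrakk>Y, Z\<rbrakk> \<otimes> Y) Z"
    and eval_universal:
      "\<lbrakk>X \<in> Obj C; Y \<in> Obj C; Z \<in> Obj C; f \<in> hom (X \<otimes> Y) Z\<rbrakk>
        \<Longrightarrow> \<exists>!g. g \<in> hom X \<lbrakk>Y, Z\<rbrakk> \<and> ev Y Z \<cdot> (g \<otimes>\<^sub>a \<one> Y) = f"

context
  fixes C :: "('o, 'a, 'x) closed_symmetric_monoidal_category_scheme" (structure)
begin

text \<open>The adjoint transpose \<open>X \<rightarrow> \<lbrakk>Y, Z\<rbrakk>\<close> of \<open>f : X \<otimes> Y \<rightarrow> Z\<close>.\<close>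
definition transpose_arr :: "'o \<Rightarrow> 'o \<Rightarrow> 'o \<Rightarrow> 'a \<Rightarrow> 'a"
  where "transpose_arr X Y Z f = (THE g. g \<in> hom X \<lbrakk>Y, Z\<rbrakk> \<and> ev Y Z \<cdot> (g \<otimes>\<^sub>a \<one> Y) = f)"

text \<open>\<open>post Y h = h\<^sub>* : \<lbrakk>Y, Z\<rbrakk> \<rightarrow> \<lbrakk>Y, Z'\<rbrakk>\<close> for \<open>h : Z \<rightarrow> Z'\<close>.\<close>
definition post :: "'o \<Rightarrow> 'a \<Rightarrow> 'a"
  where "post Y h =
    transpose_arr \<lbrakk>Y, Dom C h\<rbrakk> Y (Cod C h) (h \<cdot> ev Y (Dom C h))"

text \<open>\<open>pre h Z = h\<^sup>* : \<lbrakk>Y', Z\<rbrakk> \<rightarrow> \<lbrakk>Y, Z\<rbrakk>\<close> for \<open>h : Y \<rightarrow> Y'\<close>.\<close>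
definition pre :: "'a \<Rightarrow> 'o \<Rightarrow> 'a"
  where "pre h Z =
    transpose_arr \<lbrakk>Cod C h, Z\<rbrakk> (Dom C h) Z (ev (Cod C h) Z \<cdot> (\<one> \<lbrakk>Cod C h, Z\<rbrakk> \<otimes>\<^sub>a h))"

text \<open>The canonical isomorphism \<open>Z \<rightarrow> \<lbrakk>\<I>, Z\<rbrakk>\<close>.\<close>
definition unit_ihom :: "'o \<Rightarrow> 'a"
  where "unit_ihom Z = transpose_arr Z \<I> Z (\<rr> Z)"

text \<open>The isomorphism \<open>t : \<lbrakk>X \<otimes> Y, Z\<rbrakk> \<rightarrow> \<lbrakk>X, \<lbrakk>Y, Z\<rbrakk>\<rbrakk>\<close>.\<close>
definition tensor_ihom :: "'o \<Rightarrow> 'o \<Rightarrow> 'o \<Rightarrow> 'a"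
  where "tensor_ihom X Y Z =
    transpose_arr \<lbrakk>X \<otimes> Y, Z\<rbrakk> X \<lbrakk>Y, Z\<rbrakk>
      (transpose_arr (\<lbrakk>X \<otimes> Y, Z\<rbrakk> \<otimes> X) Y Z (ev (X \<otimes> Y) Z \<cdot> \<alpha> \<lbrakk>X \<otimes> Y, Z\<rbrakk> X Y))"

text \<open>\<open>\<mu> : X \<otimes> \<lbrakk>Y, Z\<rbrakk> \<rightarrow> \<lbrakk>Y, X \<otimes> Z\<rbrakk>\<close>.\<close>
definition mu :: "'o \<Rightarrow> 'o \<Rightarrow> 'o \<Rightarrow> 'a"
  where "mu X Y Z =
    transpose_arr (X \<otimes> \<lbrakk>Y, Z\<rbrakk>) Y (X \<otimes> Z) ((\<one> X \<otimes>\<^sub>a ev Y Z) \<cdot> \<alpha> X \<lbrakk>Y, Z\<rbrakk> Y)"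

text \<open>\<open>\<mu> : X \<otimes> \<lbrakk>M, \<I>\<rbrakk> \<rightarrow> \<lbrakk>M, X \<otimes> \<I>\<rbrakk> \<cong> \<lbrakk>M, X\<rbrakk>\<close>.\<close>
definition mu_unit :: "'o \<Rightarrow> 'o \<Rightarrow> 'a"
  where "mu_unit X M = post M (\<rr> X) \<cdot> mu X M \<I>"


section \<open>Duals, traces and cotraces\<close>

text \<open>\<open>D\<close> is a dual of \<open>M\<close> with coevaluation \<open>\<eta>\<close> and evaluation \<open>\<epsilon>\<close>.\<close>
definition dual_pair :: "'o \<Rightarrow> 'o \<Rightarrow> 'a \<Rightarrow> 'a \<Rightarrow> bool"
  where "dual_pair M D \<eta> \<epsilon> \<longleftrightarrow>
    M \<in> Obj C \<and> D \<in> Obj C \<and> \<eta> \<in> hom \<I> (M \<otimes> D) \<and> \<epsilon> \<in> hom (D \<otimes> M) \<I> \<and>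
    \<rr> M \<cdot> (\<one> M \<otimes>\<^sub>a \<epsilon>) \<cdot> \<alpha> M D M \<cdot> (\<eta> \<otimes>\<^sub>a \<one> M) \<cdot> inv_arr (\<ll> M) = \<one> M \<and>
    \<ll> D \<cdot> (\<epsilon> \<otimes>\<^sub>a \<one> D) \<cdot> inv_arr (\<alpha> D M D) \<cdot> (\<one> D \<otimes>\<^sub>a \<eta>) \<cdot> inv_arr (\<rr> D) = \<one> D"

definition dualizable :: "'o \<Rightarrow> bool"
  where "dualizable M \<longleftrightarrow> (\<exists>D \<eta> \<epsilon>. dual_pair M D \<eta> \<epsilon>)"

text \<open>The cotrace \<open>Q \<rightarrow> P\<close> of \<open>f : \<lbrakk>M, Q\<rbrakk> \<rightarrow> \<lbrakk>M, P\<rbrakk>\<close> with respect to a dual pair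
  \<open>dual_pair M D \<eta> \<epsilon>\<close>.\<close>
definition cotrace :: "'o \<Rightarrow> 'o \<Rightarrow> 'a \<Rightarrow> 'a \<Rightarrow> 'o \<Rightarrow> 'o \<Rightarrow> 'a \<Rightarrow> 'a"
  where "cotrace M D \<eta> \<epsilon> Q P f =
    inv_arr (unit_ihom P) \<cdot> pre \<eta> P \<cdot> pre (\<s> M D) P \<cdot>
    inv_arr (tensor_ihom D M P) \<cdot> post D f \<cdot> tensor_ihom D M Q \<cdot>
    pre \<epsilon> Q \<cdot> unit_ihom Q"

text \<open>The twisted trace \<open>Q \<rightarrow> P\<close> of \<open>g : Q \<otimes> N \<rightarrow> N \<otimes> P\<close> with respect to a dual pair
  \<open>dual_pair N D \<eta> \<epsilon>\<close>.\<close>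
definition trace :: "'o \<Rightarrow> 'o \<Rightarrow> 'a \<Rightarrow> 'a \<Rightarrow> 'o \<Rightarrow> 'o \<Rightarrow> 'a \<Rightarrow> 'a"
  where "trace N D \<eta> \<epsilon> Q P g =
    \<ll> P \<cdot> (\<epsilon> \<otimes>\<^sub>a \<one> P) \<cdot> inv_arr (\<alpha> D N P) \<cdot> \<s> (N \<otimes> P) D \<cdot>
    (g \<otimes>\<^sub>a \<one> D) \<cdot> inv_arr (\<alpha> Q N D) \<cdot> (\<one> Q \<otimes>\<^sub>a \<eta>) \<cdot> inv_arr (\<rr> Q)"

text \<open>\<open>g\<close> is a map \<open>Q \<otimes> \<lbrakk>M, \<I>\<rbrakk> \<rightarrow> \<lbrakk>M, \<I>\<rbrakk> \<otimes> P\<close> corresponding to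
  \<open>f : \<lbrakk>M, Q\<rbrakk> \<rightarrow> \<lbrakk>M, P\<rbrakk>\<close> under the canonical isomorphisms.\<close>
definition corresponds :: "'o \<Rightarrow> 'o \<Rightarrow> 'o \<Rightarrow> 'a \<Rightarrow> 'a \<Rightarrow> bool"
  where "corresponds M Q P f g \<longleftrightarrow>
    g \<in> hom (Q \<otimes> \<lbrakk>M, \<I>\<rbrakk>) (\<lbrakk>M, \<I>\<rbrakk> \<otimes> P) \<and>
    mu_unit P M \<cdot> \<s> \<lbrakk>M, \<I>\<rbrakk> P \<cdot> g = f \<cdot> mu_unit Q M"

end

end

theory Submission
  imports Defs
begin

text \<open>The idea of the proof. Write \<open>N = \<lbrakk>M, \<I>\<rbrakk>\<close>. Transposing along the tensor-hom adjunction removes all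
  internal homs from the cotrace except \<open>\<lbrakk>M, Q\<rbrakk>\<close> and \<open>\<lbrakk>M, P\<rbrakk>\<close>: by \<open>cotrace_formula\<close> it is the composite
  \<open>Q \<rightarrow> Q \<otimes> D \<otimes> M \<rightarrow> \<lbrakk>M, Q\<rbrakk> \<otimes> M \<rightarrow> \<lbrakk>M, P\<rbrakk> \<otimes> M \<rightarrow> P\<close> of the swapped coevaluation, the transpose
  \<open>Q \<otimes> D \<rightarrow> \<lbrakk>M, Q\<rbrakk>\<close> of \<open>1 \<otimes> \<epsilon>\<close>, the arrow \<open>f\<close>, and the evaluation \<open>ev\<close>. For \<open>D = N\<close> and
  \<open>\<epsilon> = ev\<close> this transpose is \<open>\<mu>\<close>, so that \<open>f\<close> after \<open>\<mu>\<close> can be replaced by \<open>\<mu>\<close> after \<open>s\<close> after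
  the arrow \<open>g : Q \<otimes> N \<rightarrow> N \<otimes> P\<close> corresponding to \<open>f\<close>.

  On the other side, \<open>M\<close> with swapped coevaluation and evaluation is a dual of \<open>N\<close>
  (\<open>dual_pair_swap\<close>). The trace of \<open>g\<close> with respect to this pair also starts with the swapped
  coevaluation followed by \<open>g\<close>. What remains differs only in how \<open>N \<otimes> P \<otimes> M\<close> is rearranged before
  \<open>N\<close> and \<open>M\<close> are evaluated against each other, and the two rearrangements agree by the hexagon
  axiom (\<open>symmetry_reversal\<close>, \<open>eval_mu_unit_symmetry\<close>).

  Arbitrary dual pairs are reduced to these two. Two dual pairs for one object are related by an
  arrow between the duals that is compatible with both evaluations and coevaluations
  (\<open>dual_pair_comparison\<close>), and naturality moves such an arrow from one end of the trace to the
  other. For the cotrace, the transpose \<open>D \<rightarrow> N\<close> of \<open>\<epsilon>\<close> serves the same purpose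
  (\<open>ihom_dual_pair\<close>, \<open>cotrace_via_mu_unit\<close>).

  The arrow \<open>g\<close> exists and is unique because \<open>\<mu>\<close> is invertible. Its inverse is the transpose of
  \<open>ev\<close> along the bijection between arrows \<open>X \<otimes> M \<rightarrow> Y\<close> and arrows \<open>X \<rightarrow> Y \<otimes> N\<close> that every dual
  pair provides (\<open>dual_uncurry_curry\<close>, \<open>dual_curry_uncurry\<close>).\<close>

section \<open>Calculus of arrows\<close>

context category
begin

text \<open>Typing is restated with \<open>Arr\<close>, \<open>Dom\<close> and \<open>Cod\<close> instead of hom-sets, so that the simplifier can
  discharge it: the premises then contain no objects that do not occur in the conclusion.\<close>

lemma hom_iff: "f \<in> hom X Y \<longleftrightarrow> f \<in> Arr C \<and> Dom C f = X \<and> Cod C f = Y"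
  by (simp add: hom_def)

declare Dom_Obj [simp] Cod_Obj [simp]

lemma Id_typing [simp]:
  assumes "X \<in> Obj C"
  shows "\<one> X \<in> Arr C" "Dom C (\<one> X) = X" "Cod C (\<one> X) = X"
  using Id_hom[OF assms] by (simp_all add: hom_iff)

lemma comp_typing [simp]:
  assumes "f \<in> Arr C" "g \<in> Arr C" "Dom C g = Cod C f"
  shows "g \<cdot> f \<in> Arr C" "Dom C (g \<cdot> f) = Dom C f" "Cod C (g \<cdot> f) = Cod C g"
  using Comp_hom[of f "Dom C f" "Cod C f" g "Cod C g"] assms by (simp_all add: hom_iff)

lemma comp_assoc [simp]:
  assumes "f \<in> Arr C" "g \<in> Arr C" "h \<in> Arr C" "Dom C g = Cod C f" "Dom C h = Cod C g"
  shows "(h \<cdot> g) \<cdot> f = h \<cdot> g \<cdot> f"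
  using Comp_assoc[of f "Dom C f" "Cod C f" g "Cod C g" h "Cod C h"] assms by (simp add: hom_iff)

lemma comp_Id_simps [simp]:
  assumes "f \<in> Arr C"
  shows "Dom C f = X \<Longrightarrow> f \<cdot> \<one> X = f" "Cod C f = X \<Longrightarrow> \<one> X \<cdot> f = f"
  using Comp_Id[of f "Dom C f" "Cod C f"] Id_Comp[of f "Dom C f" "Cod C f"] assms
  by (auto simp add: hom_iff)

text \<open>Composites are kept associated to the right. An equation for a composite of two or three arrows
  therefore does not match inside a longer composite; these rules extend it by an arbitrary tail,
  so that \<open>comp_reduce[OF eq]\<close> can be used for rewriting there.\<close>

lemma comp_reduce:
  assumes "g \<cdot> f = k"
    and "f \<in> Arr C" "g \<in> Arr C" "h \<in> Arr C" "Dom C g = Cod C f" "Dom C f = Cod C h"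
  shows "g \<cdot> f \<cdot> h = k \<cdot> h"
  using assms comp_assoc by metis

lemma comp_reduce3:
  assumes "g \<cdot> f \<cdot> e = k"
    and "e \<in> Arr C" "f \<in> Arr C" "g \<in> Arr C" "h \<in> Arr C"
      "Dom C g = Cod C f" "Dom C f = Cod C e" "Dom C e = Cod C h"
  shows "g \<cdot> f \<cdot> e \<cdot> h = k \<cdot> h"
  using assms comp_assoc comp_typing by metis

lemma inverse_arrows_unique:
  assumes "inverse_arrows C f g" "inverse_arrows C f h"
  shows "g = h"
proof -
  have "g = g \<cdot> f \<cdot> h"
    using assms by (simp add: inverse_arrows_def hom_iff)
  also have "\<dots> = (g \<cdot> f) \<cdot> h"
    using assms by (subst comp_assoc) (auto simp: inverse_arrows_def hom_iff)
  also have "\<dots> = h"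
    using assms by (simp add: inverse_arrows_def hom_iff)
  finally show ?thesis .
qed

lemma inv_arr_eqI: "inverse_arrows C f g \<Longrightarrow> inv_arr f = g"
  unfolding inv_arr_def by (blast intro: inverse_arrows_unique)

lemma inverse_arrows_inv_arr: "is_iso C f \<Longrightarrow> inverse_arrows C f (inv_arr f)"
  using inv_arr_eqI by (auto simp: is_iso_def)

lemma inv_arr_simps:
  assumes "is_iso C f"
  shows "inv_arr f \<in> Arr C" "Dom C (inv_arr f) = Cod C f" "Cod C (inv_arr f) = Dom C f"
    and "inv_arr f \<cdot> f = \<one> (Dom C f)" "f \<cdot> inv_arr f = \<one> (Cod C f)"
  using inverse_arrows_inv_arr[OF assms] by (auto simp: inverse_arrows_def hom_iff)

lemma is_iso_Arr: "is_iso C f \<Longrightarrow> f \<in> Arr C"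
  by (auto simp: is_iso_def inverse_arrows_def)

lemma inv_arr_cancel [simp]:
  assumes "is_iso C f" "h \<in> Arr C"
  shows "Cod C h = Dom C f \<Longrightarrow> inv_arr f \<cdot> f \<cdot> h = h"
    and "Cod C h = Cod C f \<Longrightarrow> f \<cdot> inv_arr f \<cdot> h = h"
  using assms inv_arr_simps[OF assms(1)] is_iso_Arr[OF assms(1)]
  by (simp_all add: comp_reduce)

lemma iso_left_cancel:
  assumes "f \<cdot> g = f \<cdot> h" "is_iso C f" "g \<in> Arr C" "h \<in> Arr C"
    "Cod C g = Dom C f" "Cod C h = Dom C f"
  shows "g = h"
  using assms inv_arr_cancel(1) by metis

lemma iso_right_cancel:
  assumes "g \<cdot> f = h \<cdot> f" "is_iso C f" "g \<in> Arr C" "h \<in> Arr C"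
    "Dom C g = Cod C f" "Dom C h = Cod C f"
  shows "g = h"
proof -
  have "(k \<cdot> f) \<cdot> inv_arr f = k" if "k \<in> Arr C" "Dom C k = Cod C f" for k
    using that inv_arr_simps[OF assms(2)] is_iso_Arr[OF assms(2)] by simp
  then show ?thesis
    using assms by metis
qed

lemma is_isoI:
  assumes "f \<in> hom X Y" "g \<in> hom Y X" "g \<cdot> f = \<one> X" "f \<cdot> g = \<one> Y"
  shows "is_iso C f"
  using assms by (auto simp: is_iso_def inverse_arrows_def hom_iff)

end

section \<open>Coherence of the unit and associativity isomorphisms\<close>

context monoidal_category
begin

abbreviation associator_inverse (\<open>\<alpha>i\<close>) where "\<alpha>i X Y Z \<equiv> inv_arr (\<alpha> X Y Z)"
abbreviation lunitor_inverse (\<open>\<ll>i\<close>) where "\<ll>i X \<equiv> inv_arr (\<ll> X)"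
abbreviation runitor_inverse (\<open>\<rr>i\<close>) where "\<rr>i X \<equiv> inv_arr (\<rr> X)"

declare unit_Obj [simp] tensor_Obj [simp] tensor_Id [simp]

lemma tensor_typing [simp]:
  assumes "f \<in> Arr C" "g \<in> Arr C"
  shows "f \<otimes>\<^sub>a g \<in> Arr C" "Dom C (f \<otimes>\<^sub>a g) = Dom C f \<otimes> Dom C g"
    "Cod C (f \<otimes>\<^sub>a g) = Cod C f \<otimes> Cod C g"
  using tensor_hom[of f "Dom C f" "Cod C f" g "Dom C g" "Cod C g"] assms
  by (simp_all add: hom_iff)

lemma associator_typing [simp]:
  assumes "X \<in> Obj C" "Y \<in> Obj C" "Z \<in> Obj C"
  shows "\<alpha> X Y Z \<in> Arr C" "Dom C (\<alpha> X Y Z) = (X \<otimes> Y) \<otimes> Z"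
    "Cod C (\<alpha> X Y Z) = X \<otimes> (Y \<otimes> Z)" "is_iso C (\<alpha> X Y Z)"
  using associator_hom[OF assms] associator_iso[OF assms] by (simp_all add: hom_iff)

lemma unitor_typing [simp]:
  assumes "X \<in> Obj C"
  shows "\<ll> X \<in> Arr C" "Dom C (\<ll> X) = \<I> \<otimes> X" "Cod C (\<ll> X) = X" "is_iso C (\<ll> X)"
    "\<rr> X \<in> Arr C" "Dom C (\<rr> X) = X \<otimes> \<I>" "Cod C (\<rr> X) = X" "is_iso C (\<rr> X)"
  using lunitor_hom[OF assms] lunitor_iso[OF assms] runitor_hom[OF assms] runitor_iso[OF assms]
  by (simp_all add: hom_iff)

lemma associator_inverse_simps [simp]:
  assumes "X \<in> Obj C" "Y \<in> Obj C" "Z \<in> Obj C"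
  shows "\<alpha>i X Y Z \<in> Arr C" "Dom C (\<alpha>i X Y Z) = X \<otimes> (Y \<otimes> Z)"
    "Cod C (\<alpha>i X Y Z) = (X \<otimes> Y) \<otimes> Z"
    "\<alpha>i X Y Z \<cdot> \<alpha> X Y Z = \<one> ((X \<otimes> Y) \<otimes> Z)" "\<alpha> X Y Z \<cdot> \<alpha>i X Y Z = \<one> (X \<otimes> (Y \<otimes> Z))"
  using inv_arr_simps[of "\<alpha> X Y Z"] assms by simp_all

lemma unitor_inverse_simps [simp]:
  assumes "X \<in> Obj C"
  shows "\<ll>i X \<in> Arr C" "Dom C (\<ll>i X) = X" "Cod C (\<ll>i X) = \<I> \<otimes> X"
    "\<ll>i X \<cdot> \<ll> X = \<one> (\<I> \<otimes> X)" "\<ll> X \<cdot> \<ll>i X = \<one> X"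
    "\<rr>i X \<in> Arr C" "Dom C (\<rr>i X) = X" "Cod C (\<rr>i X) = X \<otimes> \<I>"
    "\<rr>i X \<cdot> \<rr> X = \<one> (X \<otimes> \<I>)" "\<rr> X \<cdot> \<rr>i X = \<one> X"
  using inv_arr_simps[of "\<ll> X"] inv_arr_simps[of "\<rr> X"] assms by simp_all

lemma tensor_comp:
  assumes "f \<in> Arr C" "g \<in> Arr C" "f' \<in> Arr C" "g' \<in> Arr C" "Dom C f' = Cod C f" "Dom C g' = Cod C g"
  shows "(f' \<otimes>\<^sub>a g') \<cdot> (f \<otimes>\<^sub>a g) = (f' \<cdot> f) \<otimes>\<^sub>a (g' \<cdot> g)"
  using tensor_Comp[of f "Dom C f" "Cod C f" f' "Cod C f'" g "Dom C g" "Cod C g" g' "Cod C g'"] assms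
  by (simp add: hom_iff)

lemmas tensor_comp_reduce = comp_reduce[OF tensor_comp]

lemma whisker_comp:
  assumes "f \<in> Arr C" "g \<in> Arr C" "Dom C g = Cod C f" "X \<in> Obj C"
  shows "\<one> X \<otimes>\<^sub>a (g \<cdot> f) = (\<one> X \<otimes>\<^sub>a g) \<cdot> (\<one> X \<otimes>\<^sub>a f)"
    "(g \<cdot> f) \<otimes>\<^sub>a \<one> X = (g \<otimes>\<^sub>a \<one> X) \<cdot> (f \<otimes>\<^sub>a \<one> X)"
  using assms by (simp_all add: tensor_comp)

lemma interchange:
  assumes "f \<in> Arr C" "g \<in> Arr C" "Dom C f = X" "Cod C f = X'" "Dom C g = Y" "Cod C g = Y'"
  shows "(f \<otimes>\<^sub>a \<one> Y') \<cdot> (\<one> X \<otimes>\<^sub>a g) = (\<one> X' \<otimes>\<^sub>a g) \<cdot> (f \<otimes>\<^sub>a \<one> Y)"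
proof -
  have "X \<in> Obj C" "X' \<in> Obj C" "Y \<in> Obj C" "Y' \<in> Obj C"
    using assms by auto
  with assms show ?thesis
    by (simp add: tensor_comp)
qed

lemma associator_nat:
  assumes "f \<in> Arr C" "g \<in> Arr C" "h \<in> Arr C" "Cod C f = X" "Cod C g = Y" "Cod C h = Z"
  shows "\<alpha> X Y Z \<cdot> ((f \<otimes>\<^sub>a g) \<otimes>\<^sub>a h) = (f \<otimes>\<^sub>a (g \<otimes>\<^sub>a h)) \<cdot> \<alpha> (Dom C f) (Dom C g) (Dom C h)"
  using associator_natural[of f "Dom C f" X g "Dom C g" Y h "Dom C h" Z] assms by (simp add: hom_iff)

lemma associator_inverse_nat:
  assumes "f \<in> Arr C" "g \<in> Arr C" "h \<in> Arr C" "Cod C f = X" "Cod C g = Y" "Cod C h = Z"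
  shows "\<alpha>i X Y Z \<cdot> (f \<otimes>\<^sub>a (g \<otimes>\<^sub>a h)) = ((f \<otimes>\<^sub>a g) \<otimes>\<^sub>a h) \<cdot> \<alpha>i (Dom C f) (Dom C g) (Dom C h)"
proof -
  have [simp]: "X \<in> Obj C" "Y \<in> Obj C" "Z \<in> Obj C"
    using assms by auto
  note [simp] = assms
  show ?thesis
    by (rule iso_left_cancel[of "\<alpha> X Y Z"])
      (simp_all add: comp_reduce[OF associator_nat])
qed

lemma runitor_nat: "f \<in> Arr C \<Longrightarrow> Cod C f = Y \<Longrightarrow> \<rr> Y \<cdot> (f \<otimes>\<^sub>a \<one> \<I>) = f \<cdot> \<rr> (Dom C f)"
  using runitor_natural[of f "Dom C f" Y] by (simp add: hom_iff)

lemma lunitor_nat: "f \<in> Arr C \<Longrightarrow> Cod C f = Y \<Longrightarrow> \<ll> Y \<cdot> (\<one> \<I> \<otimes>\<^sub>a f) = f \<cdot> \<ll> (Dom C f)"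
  using lunitor_natural[of f "Dom C f" Y] by (simp add: hom_iff)

lemma runitor_inverse_nat:
  assumes "f \<in> Arr C" "Cod C f = Y"
  shows "\<rr>i Y \<cdot> f = (f \<otimes>\<^sub>a \<one> \<I>) \<cdot> \<rr>i (Dom C f)"
proof -
  have [simp]: "Y \<in> Obj C" using assms by auto
  note [simp] = assms
  show ?thesis
    by (rule iso_left_cancel[of "\<rr> Y"]) (simp_all add: comp_reduce[OF runitor_nat])
qed

lemma tensor_unit_faithful:
  assumes "f \<otimes>\<^sub>a \<one> \<I> = g \<otimes>\<^sub>a \<one> \<I>" "f \<in> hom X Y" "g \<in> hom X Y"
  shows "f = g"
proof -
  have [simp]: "X \<in> Obj C" using assms by (auto simp: hom_iff)
  have "f \<cdot> \<rr> X = g \<cdot> \<rr> X"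
    using runitor_natural[OF assms(2)] runitor_natural[OF assms(3)] assms(1) by simp
  then show ?thesis
    using assms(2,3) iso_right_cancel[of f "\<rr> X" g] by (simp add: hom_iff)
qed

lemma unit_tensor_faithful:
  assumes "\<one> \<I> \<otimes>\<^sub>a f = \<one> \<I> \<otimes>\<^sub>a g" "f \<in> hom X Y" "g \<in> hom X Y"
  shows "f = g"
proof -
  have [simp]: "X \<in> Obj C" using assms by (auto simp: hom_iff)
  have "f \<cdot> \<ll> X = g \<cdot> \<ll> X"
    using lunitor_natural[OF assms(2)] lunitor_natural[OF assms(3)] assms(1) by simp
  then show ?thesis
    using assms(2,3) iso_right_cancel[of f "\<ll> X" g] by (simp add: hom_iff)
qed

lemma is_iso_tensor:
  assumes "is_iso C f" "is_iso C g"
  shows "is_iso C (f \<otimes>\<^sub>a g)"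
proof (rule is_isoI)
  note [simp] = inv_arr_simps[OF assms(1)] inv_arr_simps[OF assms(2)]
    is_iso_Arr[OF assms(1)] is_iso_Arr[OF assms(2)]
  show "f \<otimes>\<^sub>a g \<in> hom (Dom C f \<otimes> Dom C g) (Cod C f \<otimes> Cod C g)"
    by (simp add: hom_iff)
  show "inv_arr f \<otimes>\<^sub>a inv_arr g \<in> hom (Cod C f \<otimes> Cod C g) (Dom C f \<otimes> Dom C g)"
    by (simp add: hom_iff)
qed (use assms in \<open>simp_all add: tensor_comp inv_arr_simps is_iso_Arr\<close>)

lemma is_iso_comp:
  assumes "is_iso C f" "is_iso C g" "Dom C g = Cod C f"
  shows "is_iso C (g \<cdot> f)"
  by (rule is_isoI[of _ "Dom C f" "Cod C g" "inv_arr f \<cdot> inv_arr g"])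
    (use assms in \<open>simp_all add: hom_iff inv_arr_simps is_iso_Arr\<close>)

lemma is_iso_Id: "X \<in> Obj C \<Longrightarrow> is_iso C (\<one> X)"
  by (rule is_isoI[of _ X X "\<one> X"]) (simp_all add: hom_iff)

text \<open>Kelly's coherence lemmas. Tensoring with the unit object is faithful, so it suffices to prove
  each equation after tensoring with \<open>\<I>\<close>; there the pentagon with two unit objects and the triangle
  axiom give it after composition with an isomorphism.\<close>

lemma lunitor_tensor:
  assumes [simp]: "X \<in> Obj C" "Y \<in> Obj C"
  shows "\<ll> (X \<otimes> Y) \<cdot> \<alpha> \<I> X Y = \<ll> X \<otimes>\<^sub>a \<one> Y"
proof (rule unit_tensor_faithful)
  let ?E = "\<alpha> \<I> (\<I> \<otimes> X) Y \<cdot> (\<alpha> \<I> \<I> X \<otimes>\<^sub>a \<one> Y)"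
  have "(\<one> \<I> \<otimes>\<^sub>a (\<ll> (X \<otimes> Y) \<cdot> \<alpha> \<I> X Y)) \<cdot> ?E
      = (\<one> \<I> \<otimes>\<^sub>a \<ll> (X \<otimes> Y)) \<cdot> (\<one> \<I> \<otimes>\<^sub>a \<alpha> \<I> X Y) \<cdot> ?E"
    by (simp add: whisker_comp)
  also have "\<dots> = (\<one> \<I> \<otimes>\<^sub>a \<ll> (X \<otimes> Y)) \<cdot> \<alpha> \<I> \<I> (X \<otimes> Y) \<cdot> \<alpha> (\<I> \<otimes> \<I>) X Y"
    by (simp add: pentagon)
  also have "\<dots> = (\<rr> \<I> \<otimes>\<^sub>a \<one> (X \<otimes> Y)) \<cdot> \<alpha> (\<I> \<otimes> \<I>) X Y"
    by (simp add: comp_reduce[OF triangle])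
  also have "\<dots> = \<alpha> \<I> X Y \<cdot> ((\<rr> \<I> \<otimes>\<^sub>a \<one> X) \<otimes>\<^sub>a \<one> Y)"
    by (simp add: associator_nat)
  also have "\<dots> = \<alpha> \<I> X Y \<cdot> ((\<one> \<I> \<otimes>\<^sub>a \<ll> X) \<otimes>\<^sub>a \<one> Y) \<cdot> (\<alpha> \<I> \<I> X \<otimes>\<^sub>a \<one> Y)"
    by (simp add: triangle flip: whisker_comp)
  also have "\<dots> = (\<one> \<I> \<otimes>\<^sub>a (\<ll> X \<otimes>\<^sub>a \<one> Y)) \<cdot> ?E"
    by (simp add: comp_reduce[OF associator_nat])
  finally show "\<one> \<I> \<otimes>\<^sub>a (\<ll> (X \<otimes> Y) \<cdot> \<alpha> \<I> X Y) = \<one> \<I> \<otimes>\<^sub>a (\<ll> X \<otimes>\<^sub>a \<one> Y)"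
    by (rule iso_right_cancel) (simp_all add: is_iso_comp is_iso_tensor is_iso_Id)
qed (simp_all add: hom_iff)

lemma runitor_tensor:
  assumes [simp]: "X \<in> Obj C" "Y \<in> Obj C"
  shows "(\<one> X \<otimes>\<^sub>a \<rr> Y) \<cdot> \<alpha> X Y \<I> = \<rr> (X \<otimes> Y)"
proof (rule tensor_unit_faithful)
  have "\<alpha> X Y \<I> \<cdot> (((\<one> X \<otimes>\<^sub>a \<rr> Y) \<cdot> \<alpha> X Y \<I>) \<otimes>\<^sub>a \<one> \<I>)
      = (\<one> X \<otimes>\<^sub>a (\<rr> Y \<otimes>\<^sub>a \<one> \<I>)) \<cdot> \<alpha> X (Y \<otimes> \<I>) \<I> \<cdot> (\<alpha> X Y \<I> \<otimes>\<^sub>a \<one> \<I>)"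
    by (simp add: whisker_comp comp_reduce[OF associator_nat])
  also have "\<dots> = (\<one> X \<otimes>\<^sub>a (\<one> Y \<otimes>\<^sub>a \<ll> \<I>)) \<cdot> (\<one> X \<otimes>\<^sub>a \<alpha> Y \<I> \<I>) \<cdot> \<alpha> X (Y \<otimes> \<I>) \<I> \<cdot> (\<alpha> X Y \<I> \<otimes>\<^sub>a \<one> \<I>)"
    by (simp add: whisker_comp flip: triangle)
  also have "\<dots> = (\<one> X \<otimes>\<^sub>a (\<one> Y \<otimes>\<^sub>a \<ll> \<I>)) \<cdot> \<alpha> X Y (\<I> \<otimes> \<I>) \<cdot> \<alpha> (X \<otimes> Y) \<I> \<I>"
    by (simp add: pentagon)
  also have "\<dots> = \<alpha> X Y \<I> \<cdot> (\<one> (X \<otimes> Y) \<otimes>\<^sub>a \<ll> \<I>) \<cdot> \<alpha> (X \<otimes> Y) \<I> \<I>"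
    using comp_reduce[OF associator_nat[of "\<one> X" "\<one> Y" "\<ll> \<I>" X Y \<I>, symmetric],
      of "\<alpha> (X \<otimes> Y) \<I> \<I>"] by simp
  also have "\<dots> = \<alpha> X Y \<I> \<cdot> (\<rr> (X \<otimes> Y) \<otimes>\<^sub>a \<one> \<I>)"
    by (simp add: triangle)
  finally show "((\<one> X \<otimes>\<^sub>a \<rr> Y) \<cdot> \<alpha> X Y \<I>) \<otimes>\<^sub>a \<one> \<I> = \<rr> (X \<otimes> Y) \<otimes>\<^sub>a \<one> \<I>"
    by (rule iso_left_cancel) simp_all
qed (simp_all add: hom_iff)

text \<open>Naturality of \<open>\<ll>\<close> at the arrow \<open>\<ll> \<I>\<close> identifies \<open>\<ll> (\<I> \<otimes> \<I>)\<close> with \<open>\<one> \<I> \<otimes>\<^sub>a \<ll> \<I>\<close>; so the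
  triangle axiom and \<open>lunitor_tensor\<close> give \<open>\<rr> \<I>\<close> and \<open>\<ll> \<I>\<close> the same tensor product with \<open>\<I>\<close>.\<close>

lemma lunitor_unit_eq_runitor_unit: "\<ll> \<I> = \<rr> \<I>"
proof (rule tensor_unit_faithful)
  have "\<ll> \<I> \<cdot> \<ll> (\<I> \<otimes> \<I>) = \<ll> \<I> \<cdot> (\<one> \<I> \<otimes>\<^sub>a \<ll> \<I>)"
    by (simp add: lunitor_nat)
  then have "\<ll> (\<I> \<otimes> \<I>) = \<one> \<I> \<otimes>\<^sub>a \<ll> \<I>"
    by (rule iso_left_cancel) simp_all
  then show "\<ll> \<I> \<otimes>\<^sub>a \<one> \<I> = \<rr> \<I> \<otimes>\<^sub>a \<one> \<I>"
    using lunitor_tensor[of \<I> \<I>] triangle[of \<I> \<I>] by simp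
qed (simp_all add: hom_iff)

lemma runitor_inverse_tensor:
  assumes [simp]: "X \<in> Obj C" "Y \<in> Obj C"
  shows "\<alpha> X Y \<I> \<cdot> \<rr>i (X \<otimes> Y) = \<one> X \<otimes>\<^sub>a \<rr>i Y"
    and "\<alpha>i X Y \<I> \<cdot> (\<one> X \<otimes>\<^sub>a \<rr>i Y) = \<rr>i (X \<otimes> Y)"
proof -
  have iso: "is_iso C (\<one> X \<otimes>\<^sub>a \<rr> Y)"
    by (simp add: is_iso_tensor is_iso_Id)
  show *: "\<alpha> X Y \<I> \<cdot> \<rr>i (X \<otimes> Y) = \<one> X \<otimes>\<^sub>a \<rr>i Y"
    by (rule iso_left_cancel[OF _ iso])
      (simp_all add: comp_reduce[OF runitor_tensor] tensor_comp)
  show "\<alpha>i X Y \<I> \<cdot> (\<one> X \<otimes>\<^sub>a \<rr>i Y) = \<rr>i (X \<otimes> Y)"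
    by (simp flip: *)
qed

lemma triangle_inverse:
  assumes [simp]: "X \<in> Obj C" "Y \<in> Obj C"
  shows "\<alpha> X \<I> Y \<cdot> (\<rr>i X \<otimes>\<^sub>a \<one> Y) = \<one> X \<otimes>\<^sub>a \<ll>i Y"
    and "(\<rr> X \<otimes>\<^sub>a \<one> Y) \<cdot> \<alpha>i X \<I> Y = \<one> X \<otimes>\<^sub>a \<ll> Y"
proof -
  have iso: "is_iso C (\<one> X \<otimes>\<^sub>a \<ll> Y)"
    by (simp add: is_iso_tensor is_iso_Id)
  show "\<alpha> X \<I> Y \<cdot> (\<rr>i X \<otimes>\<^sub>a \<one> Y) = \<one> X \<otimes>\<^sub>a \<ll>i Y"
    by (rule iso_left_cancel[OF _ iso])
      (simp_all add: comp_reduce[OF triangle] tensor_comp)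
  show "(\<rr> X \<otimes>\<^sub>a \<one> Y) \<cdot> \<alpha>i X \<I> Y = \<one> X \<otimes>\<^sub>a \<ll> Y"
    by (simp flip: triangle)
qed

text \<open>The pentagon with some of its sides inverted, in the two forms needed to slide \<open>\<alpha>\<close> past the
  zigzags below.\<close>

lemma pentagon_mixed:
  assumes [simp]: "W \<in> Obj C" "X \<in> Obj C" "Y \<in> Obj C" "Z \<in> Obj C"
  shows "\<alpha> (W \<otimes> X) Y Z \<cdot> (\<alpha>i W X Y \<otimes>\<^sub>a \<one> Z)
      = \<alpha>i W X (Y \<otimes> Z) \<cdot> (\<one> W \<otimes>\<^sub>a \<alpha> X Y Z) \<cdot> \<alpha> W (X \<otimes> Y) Z"
    and "(\<alpha> W X Y \<otimes>\<^sub>a \<one> Z) \<cdot> \<alpha>i (W \<otimes> X) Y Z \<cdot> \<alpha>i W X (Y \<otimes> Z)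
      = \<alpha>i W (X \<otimes> Y) Z \<cdot> (\<one> W \<otimes>\<^sub>a \<alpha>i X Y Z)"
proof -
  have iso: "is_iso C (\<alpha> W X Y \<otimes>\<^sub>a \<one> Z)"
    by (simp add: is_iso_tensor is_iso_Id)
  show "\<alpha> (W \<otimes> X) Y Z \<cdot> (\<alpha>i W X Y \<otimes>\<^sub>a \<one> Z)
      = \<alpha>i W X (Y \<otimes> Z) \<cdot> (\<one> W \<otimes>\<^sub>a \<alpha> X Y Z) \<cdot> \<alpha> W (X \<otimes> Y) Z"
    by (rule iso_right_cancel[OF _ iso], rule iso_left_cancel[of "\<alpha> W X (Y \<otimes> Z)"])
      (simp_all add: pentagon tensor_comp)
  have iso': "is_iso C (\<one> W \<otimes>\<^sub>a \<alpha> X Y Z)"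
    by (simp add: is_iso_tensor is_iso_Id)
  show "(\<alpha> W X Y \<otimes>\<^sub>a \<one> Z) \<cdot> \<alpha>i (W \<otimes> X) Y Z \<cdot> \<alpha>i W X (Y \<otimes> Z)
      = \<alpha>i W (X \<otimes> Y) Z \<cdot> (\<one> W \<otimes>\<^sub>a \<alpha>i X Y Z)"
    by (rule iso_left_cancel[of "\<alpha> W (X \<otimes> Y) Z"], rule iso_left_cancel[OF _ iso'])
      (simp_all add: comp_reduce3[OF pentagon] tensor_comp)
qed

end

section \<open>Dual pairs and their transposition bijections\<close>

context monoidal_category
begin

text \<open>The two triangle composites, as endomorphisms of \<open>M\<close> and \<open>D\<close>. They are kept
  as arrows, not as equations with identities, because several arguments need only one of the
  two equations, or need to move a composite from one pair to another.\<close>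

definition zigzag where
  "zigzag M D \<eta> \<epsilon> = \<rr> M \<cdot> (\<one> M \<otimes>\<^sub>a \<epsilon>) \<cdot> \<alpha> M D M \<cdot> (\<eta> \<otimes>\<^sub>a \<one> M) \<cdot> \<ll>i M"

definition cozigzag where
  "cozigzag M D \<eta> \<epsilon> = \<ll> D \<cdot> (\<epsilon> \<otimes>\<^sub>a \<one> D) \<cdot> \<alpha>i D M D \<cdot> (\<one> D \<otimes>\<^sub>a \<eta>) \<cdot> \<rr>i D"

text \<open>A dual pair makes \<open>- \<otimes> D\<close> right adjoint to \<open>- \<otimes> M\<close>. The next two definitions are the
  resulting maps between the arrows \<open>X \<otimes> M \<rightarrow> Y\<close> and the arrows \<open>X \<rightarrow> Y \<otimes> D\<close>.\<close>

definition dual_curry where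
  "dual_curry X M D \<eta> h = (h \<otimes>\<^sub>a \<one> D) \<cdot> \<alpha>i X M D \<cdot> (\<one> X \<otimes>\<^sub>a \<eta>) \<cdot> \<rr>i X"

definition dual_uncurry where
  "dual_uncurry Y M D \<epsilon> k = \<rr> Y \<cdot> (\<one> Y \<otimes>\<^sub>a \<epsilon>) \<cdot> \<alpha> Y D M \<cdot> (k \<otimes>\<^sub>a \<one> M)"

text \<open>All coherence needed for the transposition bijections is in the next two lemmas: the left-hand
  sides are what remains of the two round trips after the transposed arrow has been pulled out by
  naturality. The pentagon and the unit lemmas confine everything to the second tensor factor.\<close>

lemma zigzag_whisker:
  assumes [simp]: "X \<in> Obj C" "M \<in> Obj C" "D \<in> Obj C"
    and "\<eta> \<in> hom \<I> (M \<otimes> D)" "\<epsilon> \<in> hom (D \<otimes> M) \<I>"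
  shows "\<rr> (X \<otimes> M) \<cdot> (\<one> (X \<otimes> M) \<otimes>\<^sub>a \<epsilon>) \<cdot> \<alpha> (X \<otimes> M) D M \<cdot> (\<alpha>i X M D \<otimes>\<^sub>a \<one> M) \<cdot>
      ((\<one> X \<otimes>\<^sub>a \<eta>) \<otimes>\<^sub>a \<one> M) \<cdot> (\<rr>i X \<otimes>\<^sub>a \<one> M) = \<one> X \<otimes>\<^sub>a zigzag M D \<eta> \<epsilon>"
proof -
  have [simp]: "\<eta> \<in> Arr C" "Dom C \<eta> = \<I>" "Cod C \<eta> = M \<otimes> D"
    "\<epsilon> \<in> Arr C" "Dom C \<epsilon> = D \<otimes> M" "Cod C \<epsilon> = \<I>"
    using assms by (auto simp: hom_iff)
  have a: "\<rr> (X \<otimes> M) \<cdot> (\<one> (X \<otimes> M) \<otimes>\<^sub>a \<epsilon>) \<cdot> \<alpha>i X M (D \<otimes> M)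
      = (\<one> X \<otimes>\<^sub>a \<rr> M) \<cdot> (\<one> X \<otimes>\<^sub>a (\<one> M \<otimes>\<^sub>a \<epsilon>))"
    using associator_inverse_nat[of "\<one> X" "\<one> M" \<epsilon> X M \<I>, symmetric]
    by (simp flip: runitor_tensor)
  have c: "\<alpha> X (M \<otimes> D) M \<cdot> ((\<one> X \<otimes>\<^sub>a \<eta>) \<otimes>\<^sub>a \<one> M) = (\<one> X \<otimes>\<^sub>a (\<eta> \<otimes>\<^sub>a \<one> M)) \<cdot> \<alpha> X \<I> M"
    by (simp add: associator_nat)
  show ?thesis
    by (simp add: comp_reduce[OF pentagon_mixed(1)] comp_reduce3[OF a] comp_reduce[OF c]
        triangle_inverse zigzag_def whisker_comp)
qed

lemma cozigzag_whisker:
  assumes [simp]: "Y \<in> Obj C" "M \<in> Obj C" "D \<in> Obj C"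
    and "\<eta> \<in> hom \<I> (M \<otimes> D)" "\<epsilon> \<in> hom (D \<otimes> M) \<I>"
  shows "(\<rr> Y \<otimes>\<^sub>a \<one> D) \<cdot> ((\<one> Y \<otimes>\<^sub>a \<epsilon>) \<otimes>\<^sub>a \<one> D) \<cdot> (\<alpha> Y D M \<otimes>\<^sub>a \<one> D) \<cdot> \<alpha>i (Y \<otimes> D) M D \<cdot>
      (\<one> (Y \<otimes> D) \<otimes>\<^sub>a \<eta>) \<cdot> \<rr>i (Y \<otimes> D) = \<one> Y \<otimes>\<^sub>a cozigzag M D \<eta> \<epsilon>"
proof -
  have [simp]: "\<eta> \<in> Arr C" "Dom C \<eta> = \<I>" "Cod C \<eta> = M \<otimes> D"
    "\<epsilon> \<in> Arr C" "Dom C \<epsilon> = D \<otimes> M" "Cod C \<epsilon> = \<I>"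
    using assms by (auto simp: hom_iff)
  have a: "(\<one> (Y \<otimes> D) \<otimes>\<^sub>a \<eta>) \<cdot> \<rr>i (Y \<otimes> D)
      = \<alpha>i Y D (M \<otimes> D) \<cdot> (\<one> Y \<otimes>\<^sub>a (\<one> D \<otimes>\<^sub>a \<eta>)) \<cdot> (\<one> Y \<otimes>\<^sub>a \<rr>i D)"
    using comp_reduce[OF associator_inverse_nat[of "\<one> Y" "\<one> D" \<eta> Y D "M \<otimes> D"], of "\<one> Y \<otimes>\<^sub>a \<rr>i D"]
    by (simp add: runitor_inverse_tensor)
  have c: "((\<one> Y \<otimes>\<^sub>a \<epsilon>) \<otimes>\<^sub>a \<one> D) \<cdot> \<alpha>i Y (D \<otimes> M) D = \<alpha>i Y \<I> D \<cdot> (\<one> Y \<otimes>\<^sub>a (\<epsilon> \<otimes>\<^sub>a \<one> D))"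
    by (simp add: associator_inverse_nat)
  show ?thesis
    by (simp add: a comp_reduce3[OF pentagon_mixed(2)] comp_reduce[OF c]
        comp_reduce[OF triangle_inverse(2)] cozigzag_def whisker_comp)
qed

text \<open>Each round trip uses one of the two triangle identities.\<close>

lemma dual_uncurry_curry:
  assumes [simp]: "X \<in> Obj C" "Y \<in> Obj C" "M \<in> Obj C" "D \<in> Obj C"
    and "\<eta> \<in> hom \<I> (M \<otimes> D)" "\<epsilon> \<in> hom (D \<otimes> M) \<I>" "h \<in> hom (X \<otimes> M) Y"
    and zigzag: "zigzag M D \<eta> \<epsilon> = \<one> M"
  shows "dual_uncurry Y M D \<epsilon> (dual_curry X M D \<eta> h) = h"
proof -
  have [simp]: "\<eta> \<in> Arr C" "Dom C \<eta> = \<I>" "Cod C \<eta> = M \<otimes> D"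
    "\<epsilon> \<in> Arr C" "Dom C \<epsilon> = D \<otimes> M" "Cod C \<epsilon> = \<I>"
    "h \<in> Arr C" "Dom C h = X \<otimes> M" "Cod C h = Y"
    using assms by (auto simp: hom_iff)
  have a: "\<alpha> Y D M \<cdot> ((h \<otimes>\<^sub>a \<one> D) \<otimes>\<^sub>a \<one> M) = (h \<otimes>\<^sub>a \<one> (D \<otimes> M)) \<cdot> \<alpha> (X \<otimes> M) D M"
    by (simp add: associator_nat)
  have b: "(\<one> Y \<otimes>\<^sub>a \<epsilon>) \<cdot> (h \<otimes>\<^sub>a \<one> (D \<otimes> M)) = (h \<otimes>\<^sub>a \<one> \<I>) \<cdot> (\<one> (X \<otimes> M) \<otimes>\<^sub>a \<epsilon>)"
    by (simp add: interchange)
  have c: "\<rr> Y \<cdot> (h \<otimes>\<^sub>a \<one> \<I>) = h \<cdot> \<rr> (X \<otimes> M)"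
    by (simp add: runitor_nat)
  show ?thesis
    using zigzag_whisker[OF assms(1,3,4,5,6)]
    by (simp add: dual_uncurry_def dual_curry_def whisker_comp zigzag
        comp_reduce[OF a] comp_reduce[OF b] comp_reduce[OF c])
qed

lemma dual_curry_uncurry:
  assumes [simp]: "X \<in> Obj C" "Y \<in> Obj C" "M \<in> Obj C" "D \<in> Obj C"
    and "\<eta> \<in> hom \<I> (M \<otimes> D)" "\<epsilon> \<in> hom (D \<otimes> M) \<I>" "k \<in> hom X (Y \<otimes> D)"
    and cozigzag: "cozigzag M D \<eta> \<epsilon> = \<one> D"
  shows "dual_curry X M D \<eta> (dual_uncurry Y M D \<epsilon> k) = k"
proof -
  have [simp]: "\<eta> \<in> Arr C" "Dom C \<eta> = \<I>" "Cod C \<eta> = M \<otimes> D"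
    "\<epsilon> \<in> Arr C" "Dom C \<epsilon> = D \<otimes> M" "Cod C \<epsilon> = \<I>"
    "k \<in> Arr C" "Dom C k = X" "Cod C k = Y \<otimes> D"
    using assms by (auto simp: hom_iff)
  have a: "((k \<otimes>\<^sub>a \<one> M) \<otimes>\<^sub>a \<one> D) \<cdot> \<alpha>i X M D = \<alpha>i (Y \<otimes> D) M D \<cdot> (k \<otimes>\<^sub>a \<one> (M \<otimes> D))"
    using associator_inverse_nat[of k "\<one> M" "\<one> D" "Y \<otimes> D" M D] by simp
  have b: "(k \<otimes>\<^sub>a \<one> (M \<otimes> D)) \<cdot> (\<one> X \<otimes>\<^sub>a \<eta>) = (\<one> (Y \<otimes> D) \<otimes>\<^sub>a \<eta>) \<cdot> (k \<otimes>\<^sub>a \<one> \<I>)"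
    by (simp add: interchange)
  have c: "(k \<otimes>\<^sub>a \<one> \<I>) \<cdot> \<rr>i X = \<rr>i (Y \<otimes> D) \<cdot> k"
    by (simp add: runitor_inverse_nat)
  have "dual_curry X M D \<eta> (dual_uncurry Y M D \<epsilon> k)
      = ((\<rr> Y \<otimes>\<^sub>a \<one> D) \<cdot> ((\<one> Y \<otimes>\<^sub>a \<epsilon>) \<otimes>\<^sub>a \<one> D) \<cdot> (\<alpha> Y D M \<otimes>\<^sub>a \<one> D) \<cdot> \<alpha>i (Y \<otimes> D) M D \<cdot>
      (\<one> (Y \<otimes> D) \<otimes>\<^sub>a \<eta>) \<cdot> \<rr>i (Y \<otimes> D)) \<cdot> k"
    by (simp add: dual_uncurry_def dual_curry_def whisker_comp
        comp_reduce[OF a] comp_reduce[OF b] c)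
  also have "\<dots> = k"
    by (simp add: cozigzag_whisker assms(5,6) cozigzag)
  finally show ?thesis .
qed

text \<open>The case \<open>Y = \<I>\<close>: up to \<open>\<ll>\<close>, every arrow \<open>X \<otimes> M \<rightarrow> \<I>\<close> factors through \<open>\<epsilon>\<close>.\<close>

lemma evaluation_dual_curry:
  assumes [simp]: "X \<in> Obj C" "M \<in> Obj C" "D \<in> Obj C"
    and \<eta>: "\<eta> \<in> hom \<I> (M \<otimes> D)" and \<epsilon>: "\<epsilon> \<in> hom (D \<otimes> M) \<I>" and h: "h \<in> hom (X \<otimes> M) \<I>"
    and zigzag: "zigzag M D \<eta> \<epsilon> = \<one> M"
  shows "\<epsilon> \<cdot> ((\<ll> D \<cdot> dual_curry X M D \<eta> h) \<otimes>\<^sub>a \<one> M) = h"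
proof -
  have [simp]: "\<eta> \<in> Arr C" "Dom C \<eta> = \<I>" "Cod C \<eta> = M \<otimes> D"
    "\<epsilon> \<in> Arr C" "Dom C \<epsilon> = D \<otimes> M" "Cod C \<epsilon> = \<I>"
    "h \<in> Arr C" "Dom C h = X \<otimes> M" "Cod C h = \<I>"
    using \<eta> \<epsilon> h by (auto simp: hom_iff)
  let ?k = "dual_curry X M D \<eta> h"
  have [simp]: "?k \<in> Arr C" "Dom C ?k = X" "Cod C ?k = \<I> \<otimes> D"
    by (simp_all add: dual_curry_def)
  have "h = dual_uncurry \<I> M D \<epsilon> ?k"
    using dual_uncurry_curry[OF _ _ _ _ \<eta> \<epsilon> h zigzag] by simp
  also have "\<dots> = \<ll> \<I> \<cdot> (\<one> \<I> \<otimes>\<^sub>a \<epsilon>) \<cdot> \<alpha> \<I> D M \<cdot> (?k \<otimes>\<^sub>a \<one> M)"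
    by (simp add: dual_uncurry_def lunitor_unit_eq_runitor_unit)
  also have "\<dots> = \<epsilon> \<cdot> ((\<ll> D \<cdot> ?k) \<otimes>\<^sub>a \<one> M)"
    by (simp add: comp_reduce[OF lunitor_nat] comp_reduce[OF lunitor_tensor] whisker_comp)
  finally show ?thesis ..
qed

lemma cozigzag_eq_dual_curry: "cozigzag M D \<eta> \<epsilon> = \<ll> D \<cdot> dual_curry D M D \<eta> \<epsilon>"
  by (simp add: cozigzag_def dual_curry_def)

lemma dual_curry_natural:
  assumes [simp]: "X \<in> Obj C" "M \<in> Obj C" "D \<in> Obj C"
    and "\<eta> \<in> hom \<I> (M \<otimes> D)" "k \<in> hom W X" "h \<in> hom (X \<otimes> M) Y"
  shows "dual_curry X M D \<eta> h \<cdot> k = dual_curry W M D \<eta> (h \<cdot> (k \<otimes>\<^sub>a \<one> M))"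
proof -
  have [simp]: "\<eta> \<in> Arr C" "Dom C \<eta> = \<I>" "Cod C \<eta> = M \<otimes> D"
    "k \<in> Arr C" "Dom C k = W" "Cod C k = X" "h \<in> Arr C" "Dom C h = X \<otimes> M" "Cod C h = Y"
    using assms by (auto simp: hom_iff)
  have [simp]: "W \<in> Obj C" using Dom_Obj[of k] by simp
  have a: "((k \<otimes>\<^sub>a \<one> M) \<otimes>\<^sub>a \<one> D) \<cdot> \<alpha>i W M D = \<alpha>i X M D \<cdot> (k \<otimes>\<^sub>a \<one> (M \<otimes> D))"
    using associator_inverse_nat[of k "\<one> M" "\<one> D" X M D] by simp
  have b: "(k \<otimes>\<^sub>a \<one> (M \<otimes> D)) \<cdot> (\<one> W \<otimes>\<^sub>a \<eta>) = (\<one> X \<otimes>\<^sub>a \<eta>) \<cdot> (k \<otimes>\<^sub>a \<one> \<I>)"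
    by (simp add: interchange)
  have c: "(k \<otimes>\<^sub>a \<one> \<I>) \<cdot> \<rr>i W = \<rr>i X \<cdot> k"
    by (simp add: runitor_inverse_nat)
  show ?thesis
    by (simp add: dual_curry_def whisker_comp comp_reduce[OF a] comp_reduce[OF b] c)
qed

lemma zigzag_transport:
  assumes [simp]: "M \<in> Obj C" "D \<in> Obj C" "D' \<in> Obj C"
    and "\<eta> \<in> hom \<I> (M \<otimes> D)" "\<epsilon>' \<in> hom (D' \<otimes> M) \<I>" "\<phi> \<in> hom D D'"
  shows "zigzag M D' ((\<one> M \<otimes>\<^sub>a \<phi>) \<cdot> \<eta>) \<epsilon>' = zigzag M D \<eta> (\<epsilon>' \<cdot> (\<phi> \<otimes>\<^sub>a \<one> M))"
proof -
  have [simp]: "\<eta> \<in> Arr C" "Dom C \<eta> = \<I>" "Cod C \<eta> = M \<otimes> D"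
    "\<epsilon>' \<in> Arr C" "Dom C \<epsilon>' = D' \<otimes> M" "Cod C \<epsilon>' = \<I>" "\<phi> \<in> Arr C" "Dom C \<phi> = D" "Cod C \<phi> = D'"
    using assms by (auto simp: hom_iff)
  have a: "\<alpha> M D' M \<cdot> ((\<one> M \<otimes>\<^sub>a \<phi>) \<otimes>\<^sub>a \<one> M) = (\<one> M \<otimes>\<^sub>a (\<phi> \<otimes>\<^sub>a \<one> M)) \<cdot> \<alpha> M D M"
    by (simp add: associator_nat)
  show ?thesis
    by (simp add: zigzag_def whisker_comp comp_reduce[OF a])
qed

text \<open>The first triangle identity describes \<open>\<eta>\<close> as a solution of a transposition equation, so that
  injectivity of \<open>dual_uncurry\<close> makes \<open>\<eta>\<close> unique.\<close>

lemma zigzag_eq_Id_iff: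
  assumes [simp]: "M \<in> Obj C" "D \<in> Obj C"
    and "\<eta> \<in> hom \<I> (M \<otimes> D)" "\<epsilon> \<in> hom (D \<otimes> M) \<I>"
  shows "zigzag M D \<eta> \<epsilon> = \<one> M \<longleftrightarrow> dual_uncurry M M D \<epsilon> \<eta> = \<ll> M"
proof -
  have [simp]: "\<eta> \<in> Arr C" "Dom C \<eta> = \<I>" "Cod C \<eta> = M \<otimes> D"
    "\<epsilon> \<in> Arr C" "Dom C \<epsilon> = D \<otimes> M" "Cod C \<epsilon> = \<I>"
    using assms by (auto simp: hom_iff)
  have z: "zigzag M D \<eta> \<epsilon> = dual_uncurry M M D \<epsilon> \<eta> \<cdot> \<ll>i M"
    by (simp add: zigzag_def dual_uncurry_def)
  have [simp]: "dual_uncurry M M D \<epsilon> \<eta> \<in> Arr C" "Dom C (dual_uncurry M M D \<epsilon> \<eta>) = \<I> \<otimes> M"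
    by (simp_all add: dual_uncurry_def)
  show ?thesis
  proof
    assume "zigzag M D \<eta> \<epsilon> = \<one> M"
    then have "(dual_uncurry M M D \<epsilon> \<eta> \<cdot> \<ll>i M) \<cdot> \<ll> M = \<one> M \<cdot> \<ll> M"
      by (simp only: z)
    then show "dual_uncurry M M D \<epsilon> \<eta> = \<ll> M"
      by simp
  qed (simp add: z)
qed

lemma coevaluation_unique:
  assumes Obj: "M \<in> Obj C" "D \<in> Obj C"
    and \<eta>: "\<eta> \<in> hom \<I> (M \<otimes> D)" and \<eta>': "\<eta>' \<in> hom \<I> (M \<otimes> D)" and \<epsilon>: "\<epsilon> \<in> hom (D \<otimes> M) \<I>"
    and zigzag: "zigzag M D \<eta> \<epsilon> = \<one> M" "zigzag M D \<eta>' \<epsilon> = \<one> M"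
    and cozigzag: "cozigzag M D \<eta> \<epsilon> = \<one> D"
  shows "\<eta>' = \<eta>"
  using dual_curry_uncurry[OF unit_Obj Obj(1) Obj \<eta> \<epsilon> \<eta> cozigzag]
    dual_curry_uncurry[OF unit_Obj Obj(1) Obj \<eta> \<epsilon> \<eta>' cozigzag]
    zigzag zigzag_eq_Id_iff[OF Obj \<eta> \<epsilon>] zigzag_eq_Id_iff[OF Obj \<eta>' \<epsilon>]
  by simp

end

section \<open>Coherence of the symmetry and swapped dual pairs\<close>

context symmetric_monoidal_category
begin

lemma symmetry_typing [simp]:
  assumes "X \<in> Obj C" "Y \<in> Obj C"
  shows "\<s> X Y \<in> Arr C" "Dom C (\<s> X Y) = X \<otimes> Y" "Cod C (\<s> X Y) = Y \<otimes> X"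
    "\<s> Y X \<cdot> \<s> X Y = \<one> (X \<otimes> Y)"
  using symmetry_hom[OF assms] symmetry_involutive[OF assms] by (simp_all add: hom_iff)

lemma symmetry_iso [simp]: "X \<in> Obj C \<Longrightarrow> Y \<in> Obj C \<Longrightarrow> is_iso C (\<s> X Y)"
  by (rule is_isoI[of _ "X \<otimes> Y" "Y \<otimes> X" "\<s> Y X"]) (simp_all add: hom_iff)

lemma symmetry_cancel [simp]:
  assumes "X \<in> Obj C" "Y \<in> Obj C" "h \<in> Arr C" "Cod C h = X \<otimes> Y"
  shows "\<s> Y X \<cdot> \<s> X Y \<cdot> h = h"
  using assms comp_reduce[OF symmetry_typing(4)] by simp

lemma symmetry_nat:
  assumes "f \<in> Arr C" "g \<in> Arr C" "Cod C f = X" "Cod C g = Y"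
  shows "\<s> X Y \<cdot> (f \<otimes>\<^sub>a g) = (g \<otimes>\<^sub>a f) \<cdot> \<s> (Dom C f) (Dom C g)"
  using symmetry_natural[of f "Dom C f" X g "Dom C g" Y] assms by (simp add: hom_iff)

text \<open>Joyal and Street's argument: the hexagon at \<open>A\<close>, \<open>\<I>\<close>, \<open>\<I>\<close>, followed by \<open>\<one> \<I> \<otimes>\<^sub>a \<ll> A\<close> and
  \<open>\<ll> A\<close>, yields both sides tensored with \<open>\<I>\<close>, up to composition with isomorphisms.\<close>

lemma lunitor_symmetry:
  assumes [simp]: "A \<in> Obj C"
  shows "\<ll> A \<cdot> \<s> A \<I> = \<rr> A"
proof (rule tensor_unit_faithful)
  have 1: "(\<ll> \<I> \<otimes>\<^sub>a \<one> A) \<cdot> \<s> A (\<I> \<otimes> \<I>) = \<s> A \<I> \<cdot> (\<one> A \<otimes>\<^sub>a \<ll> \<I>)"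
    by (simp add: symmetry_nat)
  have "\<s> A \<I> \<cdot> (\<rr> A \<otimes>\<^sub>a \<one> \<I>) = \<s> A \<I> \<cdot> (\<one> A \<otimes>\<^sub>a \<ll> \<I>) \<cdot> \<alpha> A \<I> \<I>"
    by (simp add: triangle)
  also have "\<dots> = (\<ll> \<I> \<otimes>\<^sub>a \<one> A) \<cdot> \<s> A (\<I> \<otimes> \<I>) \<cdot> \<alpha> A \<I> \<I>"
    by (simp add: comp_reduce[OF 1])
  also have "\<dots> = (\<one> \<I> \<otimes>\<^sub>a \<ll> A) \<cdot> \<alpha> \<I> \<I> A \<cdot> \<s> A (\<I> \<otimes> \<I>) \<cdot> \<alpha> A \<I> \<I>"
    by (simp add: comp_reduce[OF triangle] lunitor_unit_eq_runitor_unit)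
  also have "\<dots> = (\<one> \<I> \<otimes>\<^sub>a \<ll> A) \<cdot> (\<one> \<I> \<otimes>\<^sub>a \<s> A \<I>) \<cdot> \<alpha> \<I> A \<I> \<cdot> (\<s> A \<I> \<otimes>\<^sub>a \<one> \<I>)"
    by (simp add: hexagon)
  finally have "\<ll> A \<cdot> \<s> A \<I> \<cdot> (\<rr> A \<otimes>\<^sub>a \<one> \<I>)
      = \<ll> A \<cdot> (\<one> \<I> \<otimes>\<^sub>a \<ll> A) \<cdot> (\<one> \<I> \<otimes>\<^sub>a \<s> A \<I>) \<cdot> \<alpha> \<I> A \<I> \<cdot> (\<s> A \<I> \<otimes>\<^sub>a \<one> \<I>)"
    by simp
  also have "\<dots> = \<ll> A \<cdot> \<s> A \<I> \<cdot> \<ll> (A \<otimes> \<I>) \<cdot> \<alpha> \<I> A \<I> \<cdot> (\<s> A \<I> \<otimes>\<^sub>a \<one> \<I>)"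
    by (simp add: comp_reduce[OF lunitor_nat] lunitor_nat)
  also have "\<dots> = \<ll> A \<cdot> \<s> A \<I> \<cdot> ((\<ll> A \<cdot> \<s> A \<I>) \<otimes>\<^sub>a \<one> \<I>)"
    by (simp add: comp_reduce[OF lunitor_tensor] whisker_comp)
  finally have "\<ll> A \<cdot> \<s> A \<I> \<cdot> ((\<ll> A \<cdot> \<s> A \<I>) \<otimes>\<^sub>a \<one> \<I>) = \<ll> A \<cdot> \<s> A \<I> \<cdot> (\<rr> A \<otimes>\<^sub>a \<one> \<I>)"
    by (rule sym)
  then have "\<s> A \<I> \<cdot> ((\<ll> A \<cdot> \<s> A \<I>) \<otimes>\<^sub>a \<one> \<I>) = \<s> A \<I> \<cdot> (\<rr> A \<otimes>\<^sub>a \<one> \<I>)"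
    by (rule iso_left_cancel) simp_all
  then show "(\<ll> A \<cdot> \<s> A \<I>) \<otimes>\<^sub>a \<one> \<I> = \<rr> A \<otimes>\<^sub>a \<one> \<I>"
    by (rule iso_left_cancel) simp_all
qed (simp_all add: hom_iff)

lemma runitor_symmetry:
  assumes [simp]: "A \<in> Obj C"
  shows "\<rr> A \<cdot> \<s> \<I> A = \<ll> A"
  using comp_assoc[of "\<s> \<I> A" "\<s> A \<I>" "\<ll> A"] by (simp add: lunitor_symmetry)

text \<open>Two ways to rearrange \<open>(B \<otimes> A) \<otimes> D\<close> to \<open>(B \<otimes> D) \<otimes> A\<close>, one using the hexagon at \<open>A\<close>, \<open>B\<close>,
  \<open>D\<close> and the other the inverse of the hexagon at \<open>D\<close>, \<open>B\<close>, \<open>A\<close>. The equation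
  serves twice: to swap dual pairs, and to compare the last parts of trace and cotrace.\<close>

lemma symmetry_reversal:
  assumes [simp]: "A \<in> Obj C" "B \<in> Obj C" "D \<in> Obj C"
  shows "\<s> A (B \<otimes> D) \<cdot> \<alpha> A B D \<cdot> (\<s> B A \<otimes>\<^sub>a \<one> D)
    = (\<s> D B \<otimes>\<^sub>a \<one> A) \<cdot> \<alpha>i D B A \<cdot> \<s> (B \<otimes> A) D"
proof -
  let ?mid = "(\<one> B \<otimes>\<^sub>a \<s> A D) \<cdot> \<alpha> B A D"
  have "\<alpha> B D A \<cdot> \<s> A (B \<otimes> D) \<cdot> \<alpha> A B D \<cdot> (\<s> B A \<otimes>\<^sub>a \<one> D) = ?mid"
    by (simp add: comp_reduce3[OF hexagon] tensor_comp)
  also have "?mid = \<alpha> B D A \<cdot> (\<s> D B \<otimes>\<^sub>a \<one> A) \<cdot> \<alpha>i D B A \<cdot> \<s> (B \<otimes> A) D"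
    by (rule iso_left_cancel[of "\<one> B \<otimes>\<^sub>a \<s> D A"])
      (simp_all add: comp_reduce3[OF hexagon[symmetric]] tensor_comp_reduce is_iso_tensor is_iso_Id)
  finally show ?thesis
    by (rule iso_left_cancel) simp_all
qed

lemma symmetry_lunitor_inverse:
  assumes [simp]: "A \<in> Obj C"
  shows "\<s> \<I> A \<cdot> \<ll>i A = \<rr>i A"
  by (rule iso_left_cancel[of "\<rr> A"]) (simp_all add: comp_reduce[OF runitor_symmetry])

text \<open>Swapping the roles of \<open>M\<close> and \<open>D\<close> exchanges the two triangle composites. The second lemma is the
  first one for the swapped pair, since swapping twice gives back the original pair.\<close>

lemma cozigzag_swap:
  assumes [simp]: "M \<in> Obj C" "D \<in> Obj C"
    and "\<eta> \<in> hom \<I> (M \<otimes> D)" "\<epsilon> \<in> hom (D \<otimes> M) \<I>"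
  shows "cozigzag D M (\<s> M D \<cdot> \<eta>) (\<epsilon> \<cdot> \<s> M D) = zigzag M D \<eta> \<epsilon>"
proof -
  have [simp]: "\<eta> \<in> Arr C" "Dom C \<eta> = \<I>" "Cod C \<eta> = M \<otimes> D"
    "\<epsilon> \<in> Arr C" "Dom C \<epsilon> = D \<otimes> M" "Cod C \<epsilon> = \<I>"
    using assms by (auto simp: hom_iff)
  have a: "(\<one> M \<otimes>\<^sub>a (\<s> M D \<cdot> \<eta>)) \<cdot> \<rr>i M
      = \<s> (D \<otimes> M) M \<cdot> (\<s> M D \<otimes>\<^sub>a \<one> M) \<cdot> (\<eta> \<otimes>\<^sub>a \<one> M) \<cdot> \<ll>i M"
    using comp_reduce[OF symmetry_nat[of "\<s> M D \<cdot> \<eta>" "\<one> M" "D \<otimes> M" M], of "\<ll>i M"]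
    by (simp add: whisker_comp symmetry_lunitor_inverse)
  have b: "(\<epsilon> \<otimes>\<^sub>a \<one> M) \<cdot> \<s> M (D \<otimes> M) = \<s> M \<I> \<cdot> (\<one> M \<otimes>\<^sub>a \<epsilon>)"
    by (simp add: symmetry_nat)
  have "cozigzag D M (\<s> M D \<cdot> \<eta>) (\<epsilon> \<cdot> \<s> M D)
      = \<ll> M \<cdot> (\<epsilon> \<otimes>\<^sub>a \<one> M) \<cdot> (\<s> M D \<otimes>\<^sub>a \<one> M) \<cdot> \<alpha>i M D M \<cdot>
        \<s> (D \<otimes> M) M \<cdot> (\<s> M D \<otimes>\<^sub>a \<one> M) \<cdot> (\<eta> \<otimes>\<^sub>a \<one> M) \<cdot> \<ll>i M"
    by (simp add: cozigzag_def a whisker_comp(2))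
  also have "\<dots> = \<ll> M \<cdot> (\<epsilon> \<otimes>\<^sub>a \<one> M) \<cdot> \<s> M (D \<otimes> M) \<cdot> \<alpha> M D M \<cdot> (\<eta> \<otimes>\<^sub>a \<one> M) \<cdot> \<ll>i M"
    by (simp add: comp_reduce3[OF symmetry_reversal[symmetric]] tensor_comp_reduce)
  also have "\<dots> = zigzag M D \<eta> \<epsilon>"
    by (simp add: comp_reduce[OF b] comp_reduce[OF lunitor_symmetry] zigzag_def)
  finally show ?thesis .
qed

lemma zigzag_swap:
  assumes [simp]: "M \<in> Obj C" "D \<in> Obj C"
    and "\<eta> \<in> hom \<I> (M \<otimes> D)" "\<epsilon> \<in> hom (D \<otimes> M) \<I>"
  shows "zigzag D M (\<s> M D \<cdot> \<eta>) (\<epsilon> \<cdot> \<s> M D) = cozigzag M D \<eta> \<epsilon>"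
  using cozigzag_swap[of D M "\<s> M D \<cdot> \<eta>" "\<epsilon> \<cdot> \<s> M D"] assms by (simp add: hom_iff)

end

section \<open>Internal homs\<close>

context closed_symmetric_monoidal_category
begin

declare ihom_Obj [simp]

lemma eval_typing [simp]:
  assumes "Y \<in> Obj C" "Z \<in> Obj C"
  shows "ev Y Z \<in> Arr C" "Dom C (ev Y Z) = \<lbrakk>Y, Z\<rbrakk> \<otimes> Y" "Cod C (ev Y Z) = Z"
  using eval_hom[OF assms] by (simp_all add: hom_iff)

lemma transpose_typing:
  assumes "X \<in> Obj C" "Y \<in> Obj C" "f \<in> Arr C" "Dom C f = X \<otimes> Y" "Cod C f = Z"
  shows "transpose_arr C X Y Z f \<in> Arr C" "Dom C (transpose_arr C X Y Z f) = X"
    "Cod C (transpose_arr C X Y Z f) = \<lbrakk>Y, Z\<rbrakk>"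
    and "ev Y Z \<cdot> (transpose_arr C X Y Z f \<otimes>\<^sub>a \<one> Y) = f"
proof -
  have "Z \<in> Obj C" using assms by auto
  then have "\<exists>!g. g \<in> hom X \<lbrakk>Y, Z\<rbrakk> \<and> ev Y Z \<cdot> (g \<otimes>\<^sub>a \<one> Y) = f"
    using assms by (intro eval_universal) (simp_all add: hom_iff)
  from theI'[OF this, folded transpose_arr_def]
  show "transpose_arr C X Y Z f \<in> Arr C" "Dom C (transpose_arr C X Y Z f) = X"
    "Cod C (transpose_arr C X Y Z f) = \<lbrakk>Y, Z\<rbrakk>"
    "ev Y Z \<cdot> (transpose_arr C X Y Z f \<otimes>\<^sub>a \<one> Y) = f"
    by (simp_all add: hom_iff)
qed

lemma eval_faithful:
  assumes "ev Y Z \<cdot> (g \<otimes>\<^sub>a \<one> Y) = ev Y Z \<cdot> (h \<otimes>\<^sub>a \<one> Y)"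
    and "Y \<in> Obj C" "Z \<in> Obj C" "g \<in> Arr C" "h \<in> Arr C" "Dom C h = Dom C g"
    "Cod C g = \<lbrakk>Y, Z\<rbrakk>" "Cod C h = \<lbrakk>Y, Z\<rbrakk>"
  shows "g = h"
proof -
  have "\<exists>!k. k \<in> hom (Dom C g) \<lbrakk>Y, Z\<rbrakk> \<and> ev Y Z \<cdot> (k \<otimes>\<^sub>a \<one> Y) = ev Y Z \<cdot> (g \<otimes>\<^sub>a \<one> Y)"
    using assms(2-) by (intro eval_universal) (simp_all add: hom_iff)
  then show ?thesis
    using assms by (auto simp: hom_iff)
qed

lemma post_simps [simp]:
  assumes [simp]: "Y \<in> Obj C" "h \<in> Arr C"
  shows "post C Y h \<in> Arr C" "Dom C (post C Y h) = \<lbrakk>Y, Dom C h\<rbrakk>"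
    "Cod C (post C Y h) = \<lbrakk>Y, Cod C h\<rbrakk>"
    "Cod C h = Z \<Longrightarrow> ev Y Z \<cdot> (post C Y h \<otimes>\<^sub>a \<one> Y) = h \<cdot> ev Y (Dom C h)"
  by (auto simp: post_def transpose_typing)

lemma pre_simps [simp]:
  assumes [simp]: "Z \<in> Obj C" "h \<in> Arr C"
  shows "pre C h Z \<in> Arr C" "Dom C (pre C h Z) = \<lbrakk>Cod C h, Z\<rbrakk>"
    "Cod C (pre C h Z) = \<lbrakk>Dom C h, Z\<rbrakk>"
    "Dom C h = Y \<Longrightarrow> ev Y Z \<cdot> (pre C h Z \<otimes>\<^sub>a \<one> Y) = ev (Cod C h) Z \<cdot> (\<one> \<lbrakk>Cod C h, Z\<rbrakk> \<otimes>\<^sub>a h)"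
  by (auto simp: pre_def transpose_typing)

lemma unit_ihom_simps [simp]:
  assumes [simp]: "Z \<in> Obj C"
  shows "unit_ihom C Z \<in> Arr C" "Dom C (unit_ihom C Z) = Z" "Cod C (unit_ihom C Z) = \<lbrakk>\<I>, Z\<rbrakk>"
    "ev \<I> Z \<cdot> (unit_ihom C Z \<otimes>\<^sub>a \<one> \<I>) = \<rr> Z"
  by (simp_all add: unit_ihom_def transpose_typing)

lemma tensor_ihom_simps [simp]:
  assumes [simp]: "X \<in> Obj C" "Y \<in> Obj C" "Z \<in> Obj C"
  shows "tensor_ihom C X Y Z \<in> Arr C" "Dom C (tensor_ihom C X Y Z) = \<lbrakk>X \<otimes> Y, Z\<rbrakk>"
    "Cod C (tensor_ihom C X Y Z) = \<lbrakk>X, \<lbrakk>Y, Z\<rbrakk>\<rbrakk>"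
  by (simp_all add: tensor_ihom_def transpose_typing)

lemma eval_eval_tensor_ihom:
  assumes [simp]: "X \<in> Obj C" "Y \<in> Obj C" "Z \<in> Obj C"
  shows "ev Y Z \<cdot> (ev X \<lbrakk>Y, Z\<rbrakk> \<otimes>\<^sub>a \<one> Y) \<cdot> ((tensor_ihom C X Y Z \<otimes>\<^sub>a \<one> X) \<otimes>\<^sub>a \<one> Y)
    = ev (X \<otimes> Y) Z \<cdot> \<alpha> \<lbrakk>X \<otimes> Y, Z\<rbrakk> X Y"
  by (simp add: tensor_ihom_def transpose_typing flip: whisker_comp)

lemma unit_ihom_inverse:
  assumes [simp]: "Z \<in> Obj C"
  shows "is_iso C (unit_ihom C Z)" "inv_arr (unit_ihom C Z) = ev \<I> Z \<cdot> \<rr>i \<lbrakk>\<I>, Z\<rbrakk>"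
proof -
  let ?u = "unit_ihom C Z" and ?v = "ev \<I> Z \<cdot> \<rr>i \<lbrakk>\<I>, Z\<rbrakk>"
  have "?v \<cdot> ?u = \<one> Z"
    by (simp add: runitor_inverse_nat comp_reduce[OF unit_ihom_simps(4)])
  moreover have "?u \<cdot> ?v = \<one> \<lbrakk>\<I>, Z\<rbrakk>"
  proof (rule eval_faithful[of \<I> Z])
    have "ev \<I> Z \<cdot> ((?u \<cdot> ?v) \<otimes>\<^sub>a \<one> \<I>) = \<rr> Z \<cdot> (?v \<otimes>\<^sub>a \<one> \<I>)"
      by (simp add: whisker_comp comp_reduce[OF unit_ihom_simps(4)])
    also have "\<dots> = ev \<I> Z \<cdot> (\<one> \<lbrakk>\<I>, Z\<rbrakk> \<otimes>\<^sub>a \<one> \<I>)"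
      by (simp add: runitor_nat)
    finally show "ev \<I> Z \<cdot> ((?u \<cdot> ?v) \<otimes>\<^sub>a \<one> \<I>) = ev \<I> Z \<cdot> (\<one> \<lbrakk>\<I>, Z\<rbrakk> \<otimes>\<^sub>a \<one> \<I>)" .
  qed simp_all
  ultimately have *: "inverse_arrows C ?u ?v"
    by (simp add: inverse_arrows_def hom_iff)
  then show "is_iso C ?u" "inv_arr ?u = ?v"
    by (auto simp: is_iso_def inv_arr_eqI)
qed

lemma tensor_ihom_iso:
  assumes [simp]: "X \<in> Obj C" "Y \<in> Obj C" "Z \<in> Obj C"
  shows "is_iso C (tensor_ihom C X Y Z)"
proof -
  let ?H = "\<lbrakk>X, \<lbrakk>Y, Z\<rbrakk>\<rbrakk>"
  let ?t = "tensor_ihom C X Y Z"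
  let ?u = "ev Y Z \<cdot> (ev X \<lbrakk>Y, Z\<rbrakk> \<otimes>\<^sub>a \<one> Y) \<cdot> \<alpha>i ?H X Y"
  let ?v = "transpose_arr C ?H (X \<otimes> Y) Z ?u"
  have [simp]: "?v \<in> Arr C" "Dom C ?v = ?H" "Cod C ?v = \<lbrakk>X \<otimes> Y, Z\<rbrakk>"
    by (simp_all add: transpose_typing)
  have ev_v: "ev (X \<otimes> Y) Z \<cdot> (?v \<otimes>\<^sub>a \<one> (X \<otimes> Y)) = ?u"
    by (rule transpose_typing) simp_all
  have a: "\<alpha>i ?H X Y \<cdot> (?t \<otimes>\<^sub>a \<one> (X \<otimes> Y)) = ((?t \<otimes>\<^sub>a \<one> X) \<otimes>\<^sub>a \<one> Y) \<cdot> \<alpha>i \<lbrakk>X \<otimes> Y, Z\<rbrakk> X Y"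
    using associator_inverse_nat[of ?t "\<one> X" "\<one> Y" ?H X Y] by simp
  have b: "\<alpha> \<lbrakk>X \<otimes> Y, Z\<rbrakk> X Y \<cdot> ((?v \<otimes>\<^sub>a \<one> X) \<otimes>\<^sub>a \<one> Y) = (?v \<otimes>\<^sub>a \<one> (X \<otimes> Y)) \<cdot> \<alpha> ?H X Y"
    using associator_nat[of ?v "\<one> X" "\<one> Y" "\<lbrakk>X \<otimes> Y, Z\<rbrakk>" X Y] by simp
  have 1: "?v \<cdot> ?t = \<one> \<lbrakk>X \<otimes> Y, Z\<rbrakk>"
  proof (rule eval_faithful[of "X \<otimes> Y" Z])
    show "ev (X \<otimes> Y) Z \<cdot> ((?v \<cdot> ?t) \<otimes>\<^sub>a \<one> (X \<otimes> Y)) = ev (X \<otimes> Y) Z \<cdot> (\<one> \<lbrakk>X \<otimes> Y, Z\<rbrakk> \<otimes>\<^sub>a \<one> (X \<otimes> Y))"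
      by (simp add: whisker_comp comp_reduce[OF ev_v] a comp_reduce3[OF eval_eval_tensor_ihom])
  qed simp_all
  have 2: "?t \<cdot> ?v = \<one> ?H"
  proof (rule eval_faithful[of X "\<lbrakk>Y, Z\<rbrakk>"], rule eval_faithful[of Y Z])
    show "ev Y Z \<cdot> ((ev X \<lbrakk>Y, Z\<rbrakk> \<cdot> ((?t \<cdot> ?v) \<otimes>\<^sub>a \<one> X)) \<otimes>\<^sub>a \<one> Y)
        = ev Y Z \<cdot> ((ev X \<lbrakk>Y, Z\<rbrakk> \<cdot> (\<one> ?H \<otimes>\<^sub>a \<one> X)) \<otimes>\<^sub>a \<one> Y)"
      by (simp add: whisker_comp comp_reduce3[OF eval_eval_tensor_ihom] b comp_reduce[OF ev_v])
  qed simp_all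
  show ?thesis
    by (rule is_isoI[OF _ _ 1 2]) (simp_all add: hom_iff)
qed

end

section \<open>Dual pairs in a closed category\<close>

context closed_symmetric_monoidal_category
begin

lemma dual_pair_iff:
  "dual_pair C M D \<eta> \<epsilon> \<longleftrightarrow>
    M \<in> Obj C \<and> D \<in> Obj C \<and> \<eta> \<in> hom \<I> (M \<otimes> D) \<and> \<epsilon> \<in> hom (D \<otimes> M) \<I> \<and>
    zigzag M D \<eta> \<epsilon> = \<one> M \<and> cozigzag M D \<eta> \<epsilon> = \<one> D"
  by (simp add: dual_pair_def zigzag_def cozigzag_def)

lemma dual_pair_swap:
  assumes "dual_pair C M D \<eta> \<epsilon>"
  shows "dual_pair C D M (\<s> M D \<cdot> \<eta>) (\<epsilon> \<cdot> \<s> M D)"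
  using assms by (auto simp: dual_pair_iff zigzag_swap cozigzag_swap) (auto simp: hom_iff)

text \<open>The comparison arrow is the transpose of \<open>\<epsilon>\<close> with respect to the second pair, which makes it
  compatible with the evaluations. Compatibility with the coevaluations is automatic: the image of
  \<open>\<eta>\<close> satisfies the triangle identity with \<open>\<epsilon>'\<close> that characterizes \<open>\<eta>'\<close>.\<close>

lemma dual_pair_comparison:
  assumes 1: "dual_pair C M D \<eta> \<epsilon>" and 2: "dual_pair C M D' \<eta>' \<epsilon>'"
  obtains \<phi> where "\<phi> \<in> hom D D'" "\<epsilon>' \<cdot> (\<phi> \<otimes>\<^sub>a \<one> M) = \<epsilon>" "(\<one> M \<otimes>\<^sub>a \<phi>) \<cdot> \<eta> = \<eta>'"
proof
  note [simp] = 1[unfolded dual_pair_iff hom_iff] 2[unfolded dual_pair_iff hom_iff]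
  let ?\<phi> = "\<ll> D' \<cdot> dual_curry D M D' \<eta>' \<epsilon>"
  show \<phi>: "?\<phi> \<in> hom D D'"
    by (simp add: hom_iff dual_curry_def)
  show \<epsilon>: "\<epsilon>' \<cdot> (?\<phi> \<otimes>\<^sub>a \<one> M) = \<epsilon>"
    by (rule evaluation_dual_curry) (simp_all add: hom_iff)
  show "(\<one> M \<otimes>\<^sub>a ?\<phi>) \<cdot> \<eta> = \<eta>'"
  proof (rule coevaluation_unique)
    show "zigzag M D' ((\<one> M \<otimes>\<^sub>a ?\<phi>) \<cdot> \<eta>) \<epsilon>' = \<one> M"
      using zigzag_transport[OF _ _ _ _ _ \<phi>, of M \<eta> \<epsilon>'] by (simp add: hom_iff \<epsilon>)
  qed (use \<phi> in \<open>simp_all add: hom_iff\<close>)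
qed

text \<open>The coevaluation of \<open>\<lbrakk>M, \<I>\<rbrakk>\<close> is transported from \<open>D\<close> along the transpose of \<open>\<epsilon>\<close>, which gives
  the first triangle identity. It implies that the second triangle composite \<open>k\<close> satisfies
  \<open>ev \<cdot> (k \<otimes> 1) = ev\<close>, and universality of \<open>ev\<close> forces \<open>k\<close> to be the identity.\<close>

lemma ihom_dual_pair:
  assumes 1: "dual_pair C M D \<eta> \<epsilon>"
  obtains \<phi> where "\<phi> \<in> hom D \<lbrakk>M, \<I>\<rbrakk>" "ev M \<I> \<cdot> (\<phi> \<otimes>\<^sub>a \<one> M) = \<epsilon>"
    "dual_pair C M \<lbrakk>M, \<I>\<rbrakk> ((\<one> M \<otimes>\<^sub>a \<phi>) \<cdot> \<eta>) (ev M \<I>)"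
proof
  note [simp] = 1[unfolded dual_pair_iff hom_iff]
  let ?\<phi> = "transpose_arr C D M \<I> \<epsilon>" and ?N = "\<lbrakk>M, \<I>\<rbrakk>"
  let ?\<eta> = "(\<one> M \<otimes>\<^sub>a ?\<phi>) \<cdot> \<eta>"
  show \<phi>: "?\<phi> \<in> hom D ?N" and \<epsilon>: "ev M \<I> \<cdot> (?\<phi> \<otimes>\<^sub>a \<one> M) = \<epsilon>"
    by (simp_all add: transpose_typing hom_iff)
  have \<eta>: "?\<eta> \<in> hom \<I> (M \<otimes> ?N)"
    using \<phi> by (simp add: hom_iff)
  have zz: "zigzag M ?N ?\<eta> (ev M \<I>) = \<one> M"
    using zigzag_transport[OF _ _ _ _ _ \<phi>, of M \<eta> "ev M \<I>"] by (simp add: hom_iff \<epsilon>)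
  have "cozigzag M ?N ?\<eta> (ev M \<I>) = \<one> ?N"
  proof (rule eval_faithful[of M \<I>])
    show "ev M \<I> \<cdot> (cozigzag M ?N ?\<eta> (ev M \<I>) \<otimes>\<^sub>a \<one> M) = ev M \<I> \<cdot> (\<one> ?N \<otimes>\<^sub>a \<one> M)"
      unfolding cozigzag_eq_dual_curry
      by (subst evaluation_dual_curry[OF _ _ _ \<eta> _ _ zz]) (simp_all add: hom_iff)
  qed (use \<eta> in \<open>simp_all add: hom_iff cozigzag_def\<close>)
  then show "dual_pair C M ?N ?\<eta> (ev M \<I>)"
    using \<eta> zz by (simp add: dual_pair_iff hom_iff)
qed

lemma mu_unit_simps [simp]:
  assumes [simp]: "X \<in> Obj C" "M \<in> Obj C"
  shows "mu_unit C X M \<in> Arr C" "Dom C (mu_unit C X M) = X \<otimes> \<lbrakk>M, \<I>\<rbrakk>"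
    "Cod C (mu_unit C X M) = \<lbrakk>M, X\<rbrakk>"
    and "ev M X \<cdot> (mu_unit C X M \<otimes>\<^sub>a \<one> M) = \<rr> X \<cdot> (\<one> X \<otimes>\<^sub>a ev M \<I>) \<cdot> \<alpha> X \<lbrakk>M, \<I>\<rbrakk> M"
proof -
  have [simp]: "mu C X M \<I> \<in> Arr C" "Dom C (mu C X M \<I>) = X \<otimes> \<lbrakk>M, \<I>\<rbrakk>"
    "Cod C (mu C X M \<I>) = \<lbrakk>M, X \<otimes> \<I>\<rbrakk>"
    "ev M (X \<otimes> \<I>) \<cdot> (mu C X M \<I> \<otimes>\<^sub>a \<one> M) = (\<one> X \<otimes>\<^sub>a ev M \<I>) \<cdot> \<alpha> X \<lbrakk>M, \<I>\<rbrakk> M"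
    by (simp_all add: mu_def transpose_typing)
  have post: "ev M X \<cdot> (post C M (\<rr> X) \<otimes>\<^sub>a \<one> M) = \<rr> X \<cdot> ev M (X \<otimes> \<I>)"
    by simp
  show "ev M X \<cdot> (mu_unit C X M \<otimes>\<^sub>a \<one> M) = \<rr> X \<cdot> (\<one> X \<otimes>\<^sub>a ev M \<I>) \<cdot> \<alpha> X \<lbrakk>M, \<I>\<rbrakk> M"
    by (simp add: mu_unit_def whisker_comp comp_reduce[OF post])
qed (simp_all add: mu_unit_def mu_def transpose_typing)

text \<open>Under the universal property of \<open>\<lbrakk>M, X\<rbrakk>\<close>, composition with \<open>\<mu>\<close> becomes transposition along
  the dual pair; this is why \<open>\<mu>\<close> is invertible.\<close>

lemma eval_mu_unit:
  assumes [simp]: "X \<in> Obj C" "M \<in> Obj C" and k: "k \<in> hom W (X \<otimes> \<lbrakk>M, \<I>\<rbrakk>)"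
  shows "ev M X \<cdot> ((mu_unit C X M \<cdot> k) \<otimes>\<^sub>a \<one> M) = dual_uncurry X M \<lbrakk>M, \<I>\<rbrakk> (ev M \<I>) k"
  using k by (simp add: hom_iff whisker_comp comp_reduce[OF mu_unit_simps(4)] dual_uncurry_def)

lemma mu_unit_iso:
  assumes 1: "dual_pair C M \<lbrakk>M, \<I>\<rbrakk> \<eta> (ev M \<I>)" and [simp]: "X \<in> Obj C"
  shows "is_iso C (mu_unit C X M)"
proof (rule is_isoI)
  note [simp] = 1[unfolded dual_pair_iff hom_iff]
  let ?N = "\<lbrakk>M, \<I>\<rbrakk>"
  let ?m = "mu_unit C X M" and ?v = "dual_curry \<lbrakk>M, X\<rbrakk> M ?N \<eta> (ev M X)"
  show m: "?m \<in> hom (X \<otimes> ?N) \<lbrakk>M, X\<rbrakk>" and v: "?v \<in> hom \<lbrakk>M, X\<rbrakk> (X \<otimes> ?N)"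
    by (simp_all add: hom_iff dual_curry_def)
  show "?m \<cdot> ?v = \<one> \<lbrakk>M, X\<rbrakk>"
  proof (rule eval_faithful[of M X])
    show "ev M X \<cdot> ((?m \<cdot> ?v) \<otimes>\<^sub>a \<one> M) = ev M X \<cdot> (\<one> \<lbrakk>M, X\<rbrakk> \<otimes>\<^sub>a \<one> M)"
      using eval_mu_unit[OF _ _ v] by (simp add: dual_uncurry_curry hom_iff)
  qed (use m v in \<open>simp_all add: hom_iff\<close>)
  have "?v \<cdot> ?m = dual_curry (X \<otimes> ?N) M ?N \<eta> (ev M X \<cdot> (?m \<otimes>\<^sub>a \<one> M))"
    by (rule dual_curry_natural[OF _ _ _ _ m]) (simp_all add: hom_iff)
  also have "ev M X \<cdot> (?m \<otimes>\<^sub>a \<one> M) = dual_uncurry X M ?N (ev M \<I>) (\<one> (X \<otimes> ?N))"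
    by (simp add: dual_uncurry_def)
  also have "dual_curry (X \<otimes> ?N) M ?N \<eta> \<dots> = \<one> (X \<otimes> ?N)"
    by (rule dual_curry_uncurry) (simp_all add: hom_iff)
  finally show "?v \<cdot> ?m = \<one> (X \<otimes> ?N)" .
qed

lemma corresponds_exists_unique:
  assumes 1: "dual_pair C M \<lbrakk>M, \<I>\<rbrakk> \<eta> (ev M \<I>)" and [simp]: "Q \<in> Obj C" "P \<in> Obj C"
    and f: "f \<in> hom \<lbrakk>M, Q\<rbrakk> \<lbrakk>M, P\<rbrakk>"
  shows "\<exists>!g. corresponds C M Q P f g"
proof -
  let ?N = "\<lbrakk>M, \<I>\<rbrakk>"
  have [simp]: "M \<in> Obj C" using 1 by (simp add: dual_pair_iff)
  note [simp] = f[unfolded hom_iff]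
  let ?i = "mu_unit C P M \<cdot> \<s> ?N P"
  have iso: "is_iso C ?i"
    by (rule is_iso_comp) (simp_all add: mu_unit_iso[OF 1])
  note inv = inv_arr_simps[OF iso, simplified]
  have *: "corresponds C M Q P f g \<longleftrightarrow> g \<in> hom (Q \<otimes> ?N) (?N \<otimes> P) \<and> ?i \<cdot> g = f \<cdot> mu_unit C Q M" for g
    by (auto simp: corresponds_def hom_iff)
  show ?thesis
  proof (rule ex1I)
    show "corresponds C M Q P f (inv_arr ?i \<cdot> f \<cdot> mu_unit C Q M)"
      unfolding * using inv_arr_cancel(2)[OF iso, of "f \<cdot> mu_unit C Q M"] inv by (simp add: hom_iff)
    fix g assume "corresponds C M Q P f g"
    then show "g = inv_arr ?i \<cdot> f \<cdot> mu_unit C Q M"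
      unfolding * using inv_arr_cancel(1)[OF iso, of g] by (auto simp: hom_iff)
  qed
qed

end

section \<open>Trace and cotrace\<close>

context closed_symmetric_monoidal_category
begin

text \<open>The comparison arrow \<open>\<phi>\<close>, split off from \<open>\<epsilon>\<close>, moves by naturality through the whole
  composite until it is absorbed by \<open>\<eta>\<close>.\<close>

lemma trace_dual_pair_independent:
  assumes 1: "dual_pair C N E \<eta> \<epsilon>" and 2: "dual_pair C N E' \<eta>' \<epsilon>'"
    and [simp]: "Q \<in> Obj C" "P \<in> Obj C" and g: "g \<in> hom (Q \<otimes> N) (N \<otimes> P)"
  shows "trace C N E \<eta> \<epsilon> Q P g = trace C N E' \<eta>' \<epsilon>' Q P g"
proof -
  note [simp] = 1[unfolded dual_pair_iff hom_iff] 2[unfolded dual_pair_iff hom_iff] g[unfolded hom_iff]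
  obtain \<phi> where \<phi>: "\<phi> \<in> hom E E'" and \<epsilon>: "\<epsilon>' \<cdot> (\<phi> \<otimes>\<^sub>a \<one> N) = \<epsilon>" and \<eta>: "(\<one> N \<otimes>\<^sub>a \<phi>) \<cdot> \<eta> = \<eta>'"
    using dual_pair_comparison[OF 1 2] .
  note [simp] = \<phi>[unfolded hom_iff]
  have \<epsilon>P: "\<epsilon> \<otimes>\<^sub>a \<one> P = (\<epsilon>' \<otimes>\<^sub>a \<one> P) \<cdot> ((\<phi> \<otimes>\<^sub>a \<one> N) \<otimes>\<^sub>a \<one> P)"
    by (simp flip: whisker_comp \<epsilon>)
  have Q\<eta>: "\<one> Q \<otimes>\<^sub>a \<eta>' = (\<one> Q \<otimes>\<^sub>a (\<one> N \<otimes>\<^sub>a \<phi>)) \<cdot> (\<one> Q \<otimes>\<^sub>a \<eta>)"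
    by (simp flip: whisker_comp \<eta>)
  have a: "((\<phi> \<otimes>\<^sub>a \<one> N) \<otimes>\<^sub>a \<one> P) \<cdot> \<alpha>i E N P = \<alpha>i E' N P \<cdot> (\<phi> \<otimes>\<^sub>a \<one> (N \<otimes> P))"
    using associator_inverse_nat[of \<phi> "\<one> N" "\<one> P" E' N P] by simp
  have b: "(\<phi> \<otimes>\<^sub>a \<one> (N \<otimes> P)) \<cdot> \<s> (N \<otimes> P) E = \<s> (N \<otimes> P) E' \<cdot> (\<one> (N \<otimes> P) \<otimes>\<^sub>a \<phi>)"
    by (simp add: symmetry_nat)
  have c: "(\<one> (N \<otimes> P) \<otimes>\<^sub>a \<phi>) \<cdot> (g \<otimes>\<^sub>a \<one> E) = (g \<otimes>\<^sub>a \<one> E') \<cdot> (\<one> (Q \<otimes> N) \<otimes>\<^sub>a \<phi>)"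
    by (simp add: interchange)
  have d: "(\<one> (Q \<otimes> N) \<otimes>\<^sub>a \<phi>) \<cdot> \<alpha>i Q N E = \<alpha>i Q N E' \<cdot> (\<one> Q \<otimes>\<^sub>a (\<one> N \<otimes>\<^sub>a \<phi>))"
    using associator_inverse_nat[of "\<one> Q" "\<one> N" \<phi> Q N E'] by simp
  show ?thesis
    by (simp add: trace_def \<epsilon>P Q\<eta> comp_reduce[OF a] comp_reduce[OF b] comp_reduce[OF c] comp_reduce[OF d])
qed

text \<open>Every factor of the cotrace is defined by a universal property or inverse to such an arrow, so
  each becomes explicit after evaluation. The arrow \<open>a\<close> is the transpose of \<open>1 \<otimes> \<epsilon>\<close>; it is described by its universal
  property because it will be recognized as a composite with \<open>\<mu>\<close>.\<close>

lemma cotrace_formula: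
  assumes [simp]: "M \<in> Obj C" "D \<in> Obj C" "Q \<in> Obj C" "P \<in> Obj C"
    and \<eta>: "\<eta> \<in> hom \<I> (M \<otimes> D)" and \<epsilon>: "\<epsilon> \<in> hom (D \<otimes> M) \<I>" and f: "f \<in> hom \<lbrakk>M, Q\<rbrakk> \<lbrakk>M, P\<rbrakk>"
    and a: "a \<in> hom (Q \<otimes> D) \<lbrakk>M, Q\<rbrakk>"
    and ev_a: "ev M Q \<cdot> (a \<otimes>\<^sub>a \<one> M) = \<rr> Q \<cdot> (\<one> Q \<otimes>\<^sub>a \<epsilon>) \<cdot> \<alpha> Q D M"
  shows "cotrace C M D \<eta> \<epsilon> Q P f
    = ev M P \<cdot> ((f \<cdot> a) \<otimes>\<^sub>a \<one> M) \<cdot> \<alpha>i Q D M \<cdot> (\<one> Q \<otimes>\<^sub>a (\<s> M D \<cdot> \<eta>)) \<cdot> \<rr>i Q"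
proof -
  note [simp] = \<eta>[unfolded hom_iff] \<epsilon>[unfolded hom_iff] f[unfolded hom_iff] a[unfolded hom_iff]
  note [simp] = inv_arr_simps[OF tensor_ihom_iso] unit_ihom_inverse tensor_ihom_iso
  let ?t = "tensor_ihom C D M"
  let ?p = "pre C \<epsilon> Q \<cdot> unit_ihom C Q"
  (* The arrow ?c is the composite of the first five factors of the cotrace; the remaining ones
     are ?d below and the inverse of the unit isomorphism. *)
  let ?b = "?t Q \<cdot> ?p"
  let ?c = "inv_arr (?t P) \<cdot> post C D f \<cdot> ?b"
  have ev_p: "ev (D \<otimes> M) Q \<cdot> (?p \<otimes>\<^sub>a \<one> (D \<otimes> M)) = \<rr> Q \<cdot> (\<one> Q \<otimes>\<^sub>a \<epsilon>)"
  proof -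
    have "ev (D \<otimes> M) Q \<cdot> (?p \<otimes>\<^sub>a \<one> (D \<otimes> M))
        = ev \<I> Q \<cdot> (\<one> \<lbrakk>\<I>, Q\<rbrakk> \<otimes>\<^sub>a \<epsilon>) \<cdot> (unit_ihom C Q \<otimes>\<^sub>a \<one> (D \<otimes> M))"
      by (simp add: whisker_comp comp_reduce[OF pre_simps(4)])
    also have "\<dots> = ev \<I> Q \<cdot> (unit_ihom C Q \<otimes>\<^sub>a \<one> \<I>) \<cdot> (\<one> Q \<otimes>\<^sub>a \<epsilon>)"
      by (simp add: interchange)
    finally show ?thesis
      by (simp add: comp_reduce[OF unit_ihom_simps(4)])
  qed
  have ev_b: "ev D \<lbrakk>M, Q\<rbrakk> \<cdot> (?b \<otimes>\<^sub>a \<one> D) = a"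
  proof (rule eval_faithful[of M Q])
    have 1: "\<alpha> \<lbrakk>D \<otimes> M, Q\<rbrakk> D M \<cdot> ((?p \<otimes>\<^sub>a \<one> D) \<otimes>\<^sub>a \<one> M) = (?p \<otimes>\<^sub>a \<one> (D \<otimes> M)) \<cdot> \<alpha> Q D M"
      using associator_nat[of ?p "\<one> D" "\<one> M" "\<lbrakk>D \<otimes> M, Q\<rbrakk>" D M] by simp
    have "ev M Q \<cdot> ((ev D \<lbrakk>M, Q\<rbrakk> \<cdot> (?b \<otimes>\<^sub>a \<one> D)) \<otimes>\<^sub>a \<one> M)
        = ev M Q \<cdot> (ev D \<lbrakk>M, Q\<rbrakk> \<otimes>\<^sub>a \<one> M) \<cdot> ((?t Q \<otimes>\<^sub>a \<one> D) \<otimes>\<^sub>a \<one> M) \<cdot> ((?p \<otimes>\<^sub>a \<one> D) \<otimes>\<^sub>a \<one> M)"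
      by (simp add: whisker_comp)
    also have "\<dots> = ev (D \<otimes> M) Q \<cdot> (?p \<otimes>\<^sub>a \<one> (D \<otimes> M)) \<cdot> \<alpha> Q D M"
      by (simp add: comp_reduce3[OF eval_eval_tensor_ihom] 1)
    also have "\<dots> = ev M Q \<cdot> (a \<otimes>\<^sub>a \<one> M)"
      by (simp add: comp_reduce[OF ev_p] ev_a)
    finally show "ev M Q \<cdot> ((ev D \<lbrakk>M, Q\<rbrakk> \<cdot> (?b \<otimes>\<^sub>a \<one> D)) \<otimes>\<^sub>a \<one> M) = ev M Q \<cdot> (a \<otimes>\<^sub>a \<one> M)" .
  qed simp_all
  have ev_c: "ev (D \<otimes> M) P \<cdot> (?c \<otimes>\<^sub>a \<one> (D \<otimes> M)) = ev M P \<cdot> ((f \<cdot> a) \<otimes>\<^sub>a \<one> M) \<cdot> \<alpha>i Q D M"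
  proof -
    have 1: "\<alpha> \<lbrakk>D \<otimes> M, P\<rbrakk> D M \<cdot> ((?c \<otimes>\<^sub>a \<one> D) \<otimes>\<^sub>a \<one> M) = (?c \<otimes>\<^sub>a \<one> (D \<otimes> M)) \<cdot> \<alpha> Q D M"
      using associator_nat[of ?c "\<one> D" "\<one> M" "\<lbrakk>D \<otimes> M, P\<rbrakk>" D M] by simp
    have "f \<cdot> a = f \<cdot> ev D \<lbrakk>M, Q\<rbrakk> \<cdot> (?b \<otimes>\<^sub>a \<one> D)"
      by (simp only: ev_b)
    also have "\<dots> = ev D \<lbrakk>M, P\<rbrakk> \<cdot> ((post C D f \<cdot> ?b) \<otimes>\<^sub>a \<one> D)"
      by (simp add: whisker_comp comp_reduce[OF post_simps(4)])
    also have "post C D f \<cdot> ?b = ?t P \<cdot> ?c"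
      by simp
    finally have "ev M P \<cdot> ((f \<cdot> a) \<otimes>\<^sub>a \<one> M)
        = ev M P \<cdot> (ev D \<lbrakk>M, P\<rbrakk> \<otimes>\<^sub>a \<one> M) \<cdot> ((?t P \<otimes>\<^sub>a \<one> D) \<otimes>\<^sub>a \<one> M) \<cdot> ((?c \<otimes>\<^sub>a \<one> D) \<otimes>\<^sub>a \<one> M)"
      by (simp add: whisker_comp del: inv_arr_cancel)
    also have "\<dots> = ev (D \<otimes> M) P \<cdot> (?c \<otimes>\<^sub>a \<one> (D \<otimes> M)) \<cdot> \<alpha> Q D M"
      using 1 by (simp add: comp_reduce3[OF eval_eval_tensor_ihom] del: inv_arr_cancel)
    finally have "(ev M P \<cdot> ((f \<cdot> a) \<otimes>\<^sub>a \<one> M)) \<cdot> \<alpha>i Q D M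
        = (ev (D \<otimes> M) P \<cdot> (?c \<otimes>\<^sub>a \<one> (D \<otimes> M)) \<cdot> \<alpha> Q D M) \<cdot> \<alpha>i Q D M"
      by (rule arg_cong)
    then show ?thesis
      by simp
  qed
  let ?d = "pre C \<eta> P \<cdot> pre C (\<s> M D) P"
  have ev_d: "ev \<I> P \<cdot> (?d \<otimes>\<^sub>a \<one> \<I>) = ev (D \<otimes> M) P \<cdot> (\<one> \<lbrakk>D \<otimes> M, P\<rbrakk> \<otimes>\<^sub>a (\<s> M D \<cdot> \<eta>))"
  proof -
    have "ev \<I> P \<cdot> (?d \<otimes>\<^sub>a \<one> \<I>)
        = ev (M \<otimes> D) P \<cdot> (\<one> \<lbrakk>M \<otimes> D, P\<rbrakk> \<otimes>\<^sub>a \<eta>) \<cdot> (pre C (\<s> M D) P \<otimes>\<^sub>a \<one> \<I>)"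
      by (simp add: whisker_comp comp_reduce[OF pre_simps(4)])
    also have "\<dots> = ev (M \<otimes> D) P \<cdot> (pre C (\<s> M D) P \<otimes>\<^sub>a \<one> (M \<otimes> D)) \<cdot> (\<one> \<lbrakk>D \<otimes> M, P\<rbrakk> \<otimes>\<^sub>a \<eta>)"
      by (simp add: interchange)
    also have "\<dots> = ev (D \<otimes> M) P \<cdot> (\<one> \<lbrakk>D \<otimes> M, P\<rbrakk> \<otimes>\<^sub>a (\<s> M D \<cdot> \<eta>))"
      by (simp add: comp_reduce[OF pre_simps(4)] whisker_comp)
    finally show ?thesis .
  qed
  have c: "?c \<in> hom Q \<lbrakk>D \<otimes> M, P\<rbrakk>"
    by (simp add: hom_iff)
  have "cotrace C M D \<eta> \<epsilon> Q P f = ev \<I> P \<cdot> \<rr>i \<lbrakk>\<I>, P\<rbrakk> \<cdot> ?d \<cdot> ?c"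
    by (simp add: cotrace_def)
  also have "\<dots> = ev \<I> P \<cdot> (?d \<otimes>\<^sub>a \<one> \<I>) \<cdot> (?c \<otimes>\<^sub>a \<one> \<I>) \<cdot> \<rr>i Q"
    using c by (simp add: runitor_inverse_nat whisker_comp(2))
  also have "\<dots> = ev (D \<otimes> M) P \<cdot> (\<one> \<lbrakk>D \<otimes> M, P\<rbrakk> \<otimes>\<^sub>a (\<s> M D \<cdot> \<eta>)) \<cdot> (?c \<otimes>\<^sub>a \<one> \<I>) \<cdot> \<rr>i Q"
    using c by (simp add: comp_reduce[OF ev_d])
  also have "\<dots> = ev (D \<otimes> M) P \<cdot> (?c \<otimes>\<^sub>a \<one> (D \<otimes> M)) \<cdot> (\<one> Q \<otimes>\<^sub>a (\<s> M D \<cdot> \<eta>)) \<cdot> \<rr>i Q"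
  proof -
    have "(?c \<otimes>\<^sub>a \<one> (D \<otimes> M)) \<cdot> (\<one> Q \<otimes>\<^sub>a (\<s> M D \<cdot> \<eta>))
        = (\<one> \<lbrakk>D \<otimes> M, P\<rbrakk> \<otimes>\<^sub>a (\<s> M D \<cdot> \<eta>)) \<cdot> (?c \<otimes>\<^sub>a \<one> \<I>)"
      by (rule interchange) simp_all
    from comp_reduce[OF this] show ?thesis by simp
  qed
  also have "\<dots> = ev M P \<cdot> ((f \<cdot> a) \<otimes>\<^sub>a \<one> M) \<cdot> \<alpha>i Q D M \<cdot> (\<one> Q \<otimes>\<^sub>a (\<s> M D \<cdot> \<eta>)) \<cdot> \<rr>i Q"
    using comp_reduce[OF ev_c] by simp
  finally show ?thesis .
qed

text \<open>The transpose of \<open>1 \<otimes> \<epsilon>\<close> factors as \<open>1 \<otimes> \<phi>\<close> followed by \<open>\<mu>\<close>. Moving \<open>\<phi>\<close> back to the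
  coevaluation leaves the formula for the dual \<open>\<lbrakk>M, \<I>\<rbrakk>\<close> with coevaluation transported along \<open>\<phi>\<close>.\<close>

lemma cotrace_via_mu_unit:
  assumes 1: "dual_pair C M D \<eta> \<epsilon>" and [simp]: "Q \<in> Obj C" "P \<in> Obj C"
    and f: "f \<in> hom \<lbrakk>M, Q\<rbrakk> \<lbrakk>M, P\<rbrakk>"
    and \<phi>: "\<phi> \<in> hom D \<lbrakk>M, \<I>\<rbrakk>" and \<epsilon>: "ev M \<I> \<cdot> (\<phi> \<otimes>\<^sub>a \<one> M) = \<epsilon>"
  shows "cotrace C M D \<eta> \<epsilon> Q P f
    = ev M P \<cdot> ((f \<cdot> mu_unit C Q M) \<otimes>\<^sub>a \<one> M) \<cdot> \<alpha>i Q \<lbrakk>M, \<I>\<rbrakk> M \<cdot>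
      (\<one> Q \<otimes>\<^sub>a (\<s> M \<lbrakk>M, \<I>\<rbrakk> \<cdot> (\<one> M \<otimes>\<^sub>a \<phi>) \<cdot> \<eta>)) \<cdot> \<rr>i Q"
proof -
  note [simp] = 1[unfolded dual_pair_iff hom_iff] f[unfolded hom_iff] \<phi>[unfolded hom_iff]
  let ?N = "\<lbrakk>M, \<I>\<rbrakk>"
  let ?a = "mu_unit C Q M \<cdot> (\<one> Q \<otimes>\<^sub>a \<phi>)"
  have \<alpha>: "\<alpha> Q ?N M \<cdot> ((\<one> Q \<otimes>\<^sub>a \<phi>) \<otimes>\<^sub>a \<one> M) = (\<one> Q \<otimes>\<^sub>a (\<phi> \<otimes>\<^sub>a \<one> M)) \<cdot> \<alpha> Q D M"
    by (simp add: associator_nat)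
  have "ev M Q \<cdot> (?a \<otimes>\<^sub>a \<one> M) = \<rr> Q \<cdot> (\<one> Q \<otimes>\<^sub>a \<epsilon>) \<cdot> \<alpha> Q D M"
    by (simp add: whisker_comp comp_reduce[OF mu_unit_simps(4)] \<alpha> flip: \<epsilon>)
  then have *: "cotrace C M D \<eta> \<epsilon> Q P f
      = ev M P \<cdot> ((f \<cdot> ?a) \<otimes>\<^sub>a \<one> M) \<cdot> \<alpha>i Q D M \<cdot> (\<one> Q \<otimes>\<^sub>a (\<s> M D \<cdot> \<eta>)) \<cdot> \<rr>i Q"
    by (intro cotrace_formula) (simp_all add: hom_iff)
  have a: "((\<one> Q \<otimes>\<^sub>a \<phi>) \<otimes>\<^sub>a \<one> M) \<cdot> \<alpha>i Q D M = \<alpha>i Q ?N M \<cdot> (\<one> Q \<otimes>\<^sub>a (\<phi> \<otimes>\<^sub>a \<one> M))"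
    by (simp add: associator_inverse_nat)
  have s: "\<s> M ?N \<cdot> (\<one> M \<otimes>\<^sub>a \<phi>) = (\<phi> \<otimes>\<^sub>a \<one> M) \<cdot> \<s> M D"
    by (simp add: symmetry_nat)
  show ?thesis
    by (simp add: * whisker_comp comp_reduce[OF a] comp_reduce[OF s])
qed

text \<open>The left-hand side is the end of the cotrace after \<open>f\<close> has been replaced by the corresponding
  arrow, the right-hand side the end of the trace for the swapped dual pair.\<close>

lemma eval_mu_unit_symmetry:
  assumes [simp]: "M \<in> Obj C" "P \<in> Obj C"
  shows "ev M P \<cdot> ((mu_unit C P M \<cdot> \<s> \<lbrakk>M, \<I>\<rbrakk> P) \<otimes>\<^sub>a \<one> M)
    = \<ll> P \<cdot> ((ev M \<I> \<cdot> \<s> M \<lbrakk>M, \<I>\<rbrakk>) \<otimes>\<^sub>a \<one> P) \<cdot> \<alpha>i M \<lbrakk>M, \<I>\<rbrakk> P \<cdot> \<s> (\<lbrakk>M, \<I>\<rbrakk> \<otimes> P) M"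
proof -
  let ?N = "\<lbrakk>M, \<I>\<rbrakk>"
  have a: "\<s> P \<I> \<cdot> (\<one> P \<otimes>\<^sub>a ev M \<I>) = (ev M \<I> \<otimes>\<^sub>a \<one> P) \<cdot> \<s> P (?N \<otimes> M)"
    by (simp add: symmetry_nat)
  have "ev M P \<cdot> ((mu_unit C P M \<cdot> \<s> ?N P) \<otimes>\<^sub>a \<one> M)
      = \<rr> P \<cdot> (\<one> P \<otimes>\<^sub>a ev M \<I>) \<cdot> \<alpha> P ?N M \<cdot> (\<s> ?N P \<otimes>\<^sub>a \<one> M)"
    by (simp add: whisker_comp comp_reduce[OF mu_unit_simps(4)])
  also have "\<dots> = \<ll> P \<cdot> (ev M \<I> \<otimes>\<^sub>a \<one> P) \<cdot> \<s> P (?N \<otimes> M) \<cdot> \<alpha> P ?N M \<cdot> (\<s> ?N P \<otimes>\<^sub>a \<one> M)"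
    by (simp add: comp_reduce[OF a] flip: lunitor_symmetry)
  also have "\<dots> = \<ll> P \<cdot> (ev M \<I> \<otimes>\<^sub>a \<one> P) \<cdot> (\<s> M ?N \<otimes>\<^sub>a \<one> P) \<cdot> \<alpha>i M ?N P \<cdot> \<s> (?N \<otimes> P) M"
    by (simp add: symmetry_reversal)
  finally show ?thesis
    by (simp add: whisker_comp)
qed

lemma cotrace_eq_trace:
  assumes 1: "dual_pair C M D \<eta> \<epsilon>" and 2: "dual_pair C \<lbrakk>M, \<I>\<rbrakk> E \<eta>' \<epsilon>'"
    and [simp]: "Q \<in> Obj C" "P \<in> Obj C" and f: "f \<in> hom \<lbrakk>M, Q\<rbrakk> \<lbrakk>M, P\<rbrakk>"
    and g: "corresponds C M Q P f g"
  shows "cotrace C M D \<eta> \<epsilon> Q P f = trace C \<lbrakk>M, \<I>\<rbrakk> E \<eta>' \<epsilon>' Q P g"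
proof -
  let ?N = "\<lbrakk>M, \<I>\<rbrakk>"
  obtain \<phi> where \<phi>: "\<phi> \<in> hom D ?N" and \<epsilon>: "ev M \<I> \<cdot> (\<phi> \<otimes>\<^sub>a \<one> M) = \<epsilon>"
    and MN: "dual_pair C M ?N ((\<one> M \<otimes>\<^sub>a \<phi>) \<cdot> \<eta>) (ev M \<I>)"
    using ihom_dual_pair[OF 1] .
  define \<eta>\<^sub>N where "\<eta>\<^sub>N = (\<one> M \<otimes>\<^sub>a \<phi>) \<cdot> \<eta>"
  note MN = MN[folded \<eta>\<^sub>N_def]
  note [simp] = MN[unfolded dual_pair_iff hom_iff] f[unfolded hom_iff]
  have g_hom: "g \<in> hom (Q \<otimes> ?N) (?N \<otimes> P)" and g_eq: "f \<cdot> mu_unit C Q M = (mu_unit C P M \<cdot> \<s> ?N P) \<cdot> g"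
    using g by (simp_all add: corresponds_def hom_iff)
  note [simp] = g_hom[unfolded hom_iff]
  have "cotrace C M D \<eta> \<epsilon> Q P f
      = ev M P \<cdot> (((mu_unit C P M \<cdot> \<s> ?N P) \<cdot> g) \<otimes>\<^sub>a \<one> M) \<cdot> \<alpha>i Q ?N M \<cdot> (\<one> Q \<otimes>\<^sub>a (\<s> M ?N \<cdot> \<eta>\<^sub>N)) \<cdot> \<rr>i Q"
    using cotrace_via_mu_unit[OF 1 _ _ f \<phi> \<epsilon>] by (simp only: g_eq \<eta>\<^sub>N_def assms(3,4))
  also have "\<dots> = ev M P \<cdot> ((mu_unit C P M \<cdot> \<s> ?N P) \<otimes>\<^sub>a \<one> M) \<cdot> (g \<otimes>\<^sub>a \<one> M) \<cdot> \<alpha>i Q ?N M \<cdot>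
      (\<one> Q \<otimes>\<^sub>a (\<s> M ?N \<cdot> \<eta>\<^sub>N)) \<cdot> \<rr>i Q"
    by (simp add: whisker_comp)
  also have "\<dots> = trace C ?N M (\<s> M ?N \<cdot> \<eta>\<^sub>N) (ev M \<I> \<cdot> \<s> M ?N) Q P g"
    by (simp add: comp_reduce[OF eval_mu_unit_symmetry] trace_def)
  also have "\<dots> = trace C ?N E \<eta>' \<epsilon>' Q P g"
    by (rule trace_dual_pair_independent[OF dual_pair_swap[OF MN] 2 _ _ g_hom]) simp_all
  finally show ?thesis .
qed

end

theorem proposition4p9:
  fixes C :: "('o, 'a, 'x) closed_symmetric_monoidal_category_scheme" (structure)
    and M Q P :: 'o and f :: 'a
  assumes "closed_symmetric_monoidal_category C"
    and "dualizable C M"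
    and "Q \<in> Obj C" and "P \<in> Obj C"
    and "f \<in> hom \<lbrakk>M, Q\<rbrakk> \<lbrakk>M, P\<rbrakk>"
  shows "dualizable C \<lbrakk>M, \<I>\<rbrakk> \<and>
    (\<exists>!f'. corresponds C M Q P f f') \<and>
    (\<forall>f' D \<eta> \<epsilon> E \<eta>' \<epsilon>'.
      corresponds C M Q P f f' \<and> dual_pair C M D \<eta> \<epsilon> \<and> dual_pair C \<lbrakk>M, \<I>\<rbrakk> E \<eta>' \<epsilon>'
      \<longrightarrow> cotrace C M D \<eta> \<epsilon> Q P f = trace C \<lbrakk>M, \<I>\<rbrakk> E \<eta>' \<epsilon>' Q P f')"
proof -
  interpret closed_symmetric_monoidal_category C
    by fact
  obtain D \<eta> \<epsilon> where "dual_pair C M D \<eta> \<epsilon>"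
    using assms(2) by (auto simp: dualizable_def)
  then obtain \<eta>\<^sub>N where MN: "dual_pair C M \<lbrakk>M, \<I>\<rbrakk> \<eta>\<^sub>N (ev M \<I>)"
    by (rule ihom_dual_pair)
  have "dualizable C \<lbrakk>M, \<I>\<rbrakk>"
    using dual_pair_swap[OF MN] by (auto simp: dualizable_def)
  moreover have "\<exists>!f'. corresponds C M Q P f f'"
    by (rule corresponds_exists_unique[OF MN assms(3-5)])
  ultimately show ?thesis
    using cotrace_eq_trace assms(3-5) by blast
qed

end
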